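(* Let $(\mathfrak g,[\cdot,\cdot,\cdot]_{\mathfrak g})$ and $(\mathfrak h,[\cdot,\cdot,\cdot]_{\mathfrak h})$ be two $3$-Lie algebras over $\mathbb K$ and let $(\mathfrak g\oplus\mathfrak h,[\cdot,\cdot,\cdot]_{(\rho,\nu,\omega)})$ be a non-abelian extension of the $3$-Lie algebra $\mathfrak g$ by $\mathfrak h$. Then the Leibniz algebra $(\wedge^2(\mathfrak g\oplus\mathfrak h),[\cdot,\cdot]_{\rm\hat F})$ is a non-abelian extension of the Leibniz algebra $(\wedge^2\mathfrak g,[\cdot,\cdot]_{\rm F})$ by the Leibniz algebra $((\wedge^2\mathfrak h)\oplus(\mathfrak g\otimes\mathfrak h),\{\cdot,\cdot\})$.
   Context: $\mathbb K$ is an algebraically closed field of characteristic $0$; all vector spaces are over $\mathbb K$. **3-Lie algebras.** A $3$-Lie algebra is a vector space $\mathfrak g$ with a skew-symmetric linear map $[\cdot,\cdot,\cdot]_{\mathfrak g}:\wedge^3\mathfrak g\to\mathfrak g$ such that for all $x_i\in\mathfrak g$, $[x_1,x_2,[x_3,x_4,x_5]]=[[x_1,x_2,x_3],x_4,x_5]+[x_3,[x_1,x_2,x_4],x_5]+[x_3,x_4,[x_1,x_2,x_5]]$. **Extensions of 3-Lie algebras.** A non-abelian extension of $\mathfrak g$ by $\mathfrak h$ is a short exact sequence of $3$-Lie algebra morphisms $0\to\mathfrak h\to\hat{\mathfrak g}\to\mathfrak g\to0$. Given linear maps $\rho:\wedge^2\mathfrak g\to\mathfrak{gl}(\mathfrak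 h)$, $\nu:\mathfrak g\to\mathrm{Hom}(\wedge^2\mathfrak h,\mathfrak h)$, $\omega:\wedge^3\mathfrak g\to\mathfrak h$, define on $\mathfrak g\oplus\mathfrak h$ $$\begin{aligned}[x_1+v_1,x_2+v_2,x_3+v_3]_{(\rho,\nu,\omega)}=&[x_1,x_2,x_3]_{\mathfrak g}+\omega(x_1,x_2,x_3)+\rho(x_1,x_2)v_3+\rho(x_2,x_3)v_1+\rho(x_3,x_1)v_2\\&+\nu(x_1)(v_2,v_3)+\nu(x_2)(v_3,v_1)+\nu(x_3)(v_1,v_2)+[v_1,v_2,v_3]_{\mathfrak h}.\end{aligned}$$ When this is a $3$-Lie bracket, $(\mathfrak g\oplus\mathfrak h,[\cdot,\cdot,\cdot]_{(\rho,\nu,\omega)})$ is a non-abelian extension of $\mathfrak g$ by $\mathfrak h$ via the inclusion of $\mathfrak h$ and the projection onto $\mathfrak g$. **Leibniz algebras.** A (left) Leibniz algebra is a vector space $\mathfrak k$ with a linear map $[\cdot,\cdot]_{\mathfrak k}:\mathfrak k\otimes\mathfrak k\to\mathfrak k$ such that $[x,[y,z]]=[[x,y],z]+[y,[x,z]]$ for all $x,y,z$. A non-abelian extension of a Leibniz algebra $\mathfrak k$ by a Leibniz algebra $\mathfrak s$ is a Leibniz algebra $\hat{\mathfrak k}$ with a short exact sequence of Leibniz algebras $0\to\mathfrak s\to\hat{\mathfrak k}\to\mathfrak k\to0$. **Fundamental objects.** For a $3$-Lie algebra $\mathfrak g$, the space $\wedge^2\mathfrak g$ is a Leibniz algebra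 (known) under $[x_1\wedge x_2,y_1\wedge y_2]_{\rm F}=[x_1,x_2,y_1]_{\mathfrak g}\wedge y_2+y_1\wedge[x_1,x_2,y_2]_{\mathfrak g}$. The same bracket for the $3$-Lie algebra $(\mathfrak g\oplus\mathfrak h,[\cdot,\cdot,\cdot]_{(\rho,\nu,\omega)})$, on $\wedge^2(\mathfrak g\oplus\mathfrak h)$, is denoted $[\cdot,\cdot]_{\rm\hat F}$. There is the natural identification $\wedge^2(\mathfrak g\oplus\mathfrak h)\cong((\wedge^2\mathfrak h)\oplus(\mathfrak g\otimes\mathfrak h))\oplus(\wedge^2\mathfrak g)$, with $x\otimes w$ corresponding to $x\wedge w$ for $x\in\mathfrak g$, $w\in\mathfrak h$. **The bracket $\{\cdot,\cdot\}$.** On $(\wedge^2\mathfrak h)\oplus(\mathfrak g\otimes\mathfrak h)$, for $x_i\in\mathfrak g$ and $u_i,v_i,w_i\in\mathfrak h$, $$\begin{aligned}&\{u_1\wedge v_1+x_1\otimes w_1,\,u_2\wedge v_2+x_2\otimes w_2\}\\&=[u_1,v_1,u_2]_{\mathfrak h}\wedge v_2+u_2\wedge[u_1,v_1,v_2]_{\mathfrak h}+\nu(x_2)(u_1,v_1)\wedge w_2+x_2\otimes[u_1,v_1,w_2]_{\mathfrak h}\\&\quad+\nu(x_1)(w_1,u_2)\wedge v_2+u_2\wedge\nu(x_1)(w_1,v_2)-\rho(x_1,x_2)(w_1)\wedge w_2+x_2\otimes\nu(x_1)(w_1,w_2).\end{aligned}$$ *)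

theory Defs
  imports "Jordan_Normal_Form.Missing_VectorSpace" "HOL-Algebra.Algebraic_Closure"
begin

hide_const (open) Modules.module Modules.module_hom Multiset.mult

section \<open>Multilinear maps\<close>

definition bilinear ::
  "('k, 'r) ring_scheme \<Rightarrow> ('k, 'a, 'm) module_scheme \<Rightarrow> ('k, 'b, 'n) module_scheme
    \<Rightarrow> ('k, 'c, 'p) module_scheme \<Rightarrow> ('a \<Rightarrow> 'b \<Rightarrow> 'c) \<Rightarrow> bool"
  where "bilinear K U V W f \<longleftrightarrow>
    (\<forall>u\<in>carrier U. (\<lambda>v. f u v) \<in> module_hom K V W) \<and>
    (\<forall>v\<in>carrier V. (\<lambda>u. f u v) \<in> module_hom K U W)"

definition trilinear ::
  "('k, 'r) ring_scheme \<Rightarrow> ('k, 'a, 'm) module_scheme \<Rightarrow> ('k, 'b, 'n) module_scheme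
    \<Rightarrow> ('k, 'c, 'p) module_scheme \<Rightarrow> ('k, 'd, 'q) module_scheme \<Rightarrow> ('a \<Rightarrow> 'b \<Rightarrow> 'c \<Rightarrow> 'd) \<Rightarrow> bool"
  where "trilinear K A B C D f \<longleftrightarrow>
    (\<forall>x\<in>carrier A. \<forall>y\<in>carrier B. (\<lambda>z. f x y z) \<in> module_hom K C D) \<and>
    (\<forall>x\<in>carrier A. \<forall>z\<in>carrier C. (\<lambda>y. f x y z) \<in> module_hom K B D) \<and>
    (\<forall>y\<in>carrier B. \<forall>z\<in>carrier C. (\<lambda>x. f x y z) \<in> module_hom K A D)"

text \<open>A linear map out of the third exterior power, written as an alternating trilinear map.\<close>

definition alternating_trilinear ::
  "('k, 'r) ring_scheme \<Rightarrow> ('k, 'a, 'm) module_scheme \<Rightarrow> ('k, 'b, 'n) module_scheme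
    \<Rightarrow> ('a \<Rightarrow> 'a \<Rightarrow> 'a \<Rightarrow> 'b) \<Rightarrow> bool"
  where "alternating_trilinear K V W f \<longleftrightarrow> trilinear K V V V W f \<and>
    (\<forall>x\<in>carrier V. \<forall>y\<in>carrier V. \<forall>z\<in>carrier V.
      x = y \<or> y = z \<or> x = z \<longrightarrow> f x y z = \<zero>\<^bsub>W\<^esub>)"


section \<open>3-Lie algebras, Leibniz algebras and their extensions\<close>

definition three_lie_algebra ::
  "('k, 'r) ring_scheme \<Rightarrow> ('k, 'a, 'm) module_scheme \<Rightarrow> ('a \<Rightarrow> 'a \<Rightarrow> 'a \<Rightarrow> 'a) \<Rightarrow> bool"
  where "three_lie_algebra K V br \<longleftrightarrow> vectorspace K V \<and> alternating_trilinear K V V br \<and>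
    (\<forall>x1\<in>carrier V. \<forall>x2\<in>carrier V. \<forall>x3\<in>carrier V. \<forall>x4\<in>carrier V. \<forall>x5\<in>carrier V.
      br x1 x2 (br x3 x4 x5) =
        br (br x1 x2 x3) x4 x5 \<oplus>\<^bsub>V\<^esub> br x3 (br x1 x2 x4) x5 \<oplus>\<^bsub>V\<^esub> br x3 x4 (br x1 x2 x5))"

definition three_lie_hom ::
  "('k, 'r) ring_scheme \<Rightarrow> ('k, 'a, 'm) module_scheme \<Rightarrow> ('a \<Rightarrow> 'a \<Rightarrow> 'a \<Rightarrow> 'a)
    \<Rightarrow> ('k, 'b, 'n) module_scheme \<Rightarrow> ('b \<Rightarrow> 'b \<Rightarrow> 'b \<Rightarrow> 'b) \<Rightarrow> ('a \<Rightarrow> 'b) \<Rightarrow> bool"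
  where "three_lie_hom K V brV W brW f \<longleftrightarrow> linear_map K V W f \<and>
    (\<forall>x\<in>carrier V. \<forall>y\<in>carrier V. \<forall>z\<in>carrier V. f (brV x y z) = brW (f x) (f y) (f z))"

definition leibniz_algebra ::
  "('k, 'r) ring_scheme \<Rightarrow> ('k, 'a, 'm) module_scheme \<Rightarrow> ('a \<Rightarrow> 'a \<Rightarrow> 'a) \<Rightarrow> bool"
  where "leibniz_algebra K V br \<longleftrightarrow> vectorspace K V \<and> bilinear K V V V br \<and>
    (\<forall>x\<in>carrier V. \<forall>y\<in>carrier V. \<forall>z\<in>carrier V.
      br x (br y z) = br (br x y) z \<oplus>\<^bsub>V\<^esub> br y (br x z))"

definition leibniz_hom ::
  "('k, 'r) ring_scheme \<Rightarrow> ('k, 'a, 'm) module_scheme \<Rightarrow> ('a \<Rightarrow> 'a \<Rightarrow> 'a)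
    \<Rightarrow> ('k, 'b, 'n) module_scheme \<Rightarrow> ('b \<Rightarrow> 'b \<Rightarrow> 'b) \<Rightarrow> ('a \<Rightarrow> 'b) \<Rightarrow> bool"
  where "leibniz_hom K V brV W brW f \<longleftrightarrow> linear_map K V W f \<and>
    (\<forall>x\<in>carrier V. \<forall>y\<in>carrier V. f (brV x y) = brW (f x) (f y))"

definition short_exact ::
  "('k, 'a, 'm) module_scheme \<Rightarrow> ('k, 'b, 'n) module_scheme \<Rightarrow> ('k, 'c, 'p) module_scheme
    \<Rightarrow> ('a \<Rightarrow> 'b) \<Rightarrow> ('b \<Rightarrow> 'c) \<Rightarrow> bool"
  where "short_exact A B C i p \<longleftrightarrow>
    inj_on i (carrier A) \<and> i ` carrier A = a_kernel B C p \<and> p ` carrier B = carrier C"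

text \<open>In the next two definitions the middle term \<open>E\<close> is a (non-abelian) extension of \<open>Q\<close> by \<open>S\<close>,
  with structure maps \<open>i\<close> and \<open>p\<close>.\<close>

definition three_lie_extension ::
  "('k, 'r) ring_scheme \<Rightarrow> ('k, 'a, 'm) module_scheme \<Rightarrow> ('a \<Rightarrow> 'a \<Rightarrow> 'a \<Rightarrow> 'a)
    \<Rightarrow> ('k, 'b, 'n) module_scheme \<Rightarrow> ('b \<Rightarrow> 'b \<Rightarrow> 'b \<Rightarrow> 'b)
    \<Rightarrow> ('k, 'c, 'p) module_scheme \<Rightarrow> ('c \<Rightarrow> 'c \<Rightarrow> 'c \<Rightarrow> 'c) \<Rightarrow> ('a \<Rightarrow> 'b) \<Rightarrow> ('b \<Rightarrow> 'c) \<Rightarrow> bool"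
  where "three_lie_extension K S brS E brE Q brQ i p \<longleftrightarrow>
    three_lie_algebra K S brS \<and> three_lie_algebra K E brE \<and> three_lie_algebra K Q brQ \<and>
    three_lie_hom K S brS E brE i \<and> three_lie_hom K E brE Q brQ p \<and> short_exact S E Q i p"

definition leibniz_extension ::
  "('k, 'r) ring_scheme \<Rightarrow> ('k, 'a, 'm) module_scheme \<Rightarrow> ('a \<Rightarrow> 'a \<Rightarrow> 'a)
    \<Rightarrow> ('k, 'b, 'n) module_scheme \<Rightarrow> ('b \<Rightarrow> 'b \<Rightarrow> 'b)
    \<Rightarrow> ('k, 'c, 'p) module_scheme \<Rightarrow> ('c \<Rightarrow> 'c \<Rightarrow> 'c) \<Rightarrow> ('a \<Rightarrow> 'b) \<Rightarrow> ('b \<Rightarrow> 'c) \<Rightarrow> bool"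
  where "leibniz_extension K S brS E brE Q brQ i p \<longleftrightarrow>
    leibniz_algebra K S brS \<and> leibniz_algebra K E brE \<and> leibniz_algebra K Q brQ \<and>
    leibniz_hom K S brS E brE i \<and> leibniz_hom K E brE Q brQ p \<and> short_exact S E Q i p"


section \<open>Tensor products and exterior squares\<close>

text \<open>Both are quotients of a free vector space by a span of relations. The fields \<open>mult\<close> and
  \<open>one\<close> of a module record play no role.\<close>

definition free_space :: "('k, 'r) ring_scheme \<Rightarrow> 'x set \<Rightarrow> ('k, 'x \<Rightarrow> 'k) module"
  where "free_space K B =
    \<lparr>carrier = {f. (\<forall>x. f x \<in> carrier K) \<and> finite {x. f x \<noteq> \<zero>\<^bsub>K\<^esub>} \<and> {x. f x \<noteq> \<zero>\<^bsub>K\<^esub>} \<subseteq> B},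
     mult = (\<lambda>f g x. \<zero>\<^bsub>K\<^esub>), one = (\<lambda>x. \<zero>\<^bsub>K\<^esub>), zero = (\<lambda>x. \<zero>\<^bsub>K\<^esub>),
     add = (\<lambda>f g x. f x \<oplus>\<^bsub>K\<^esub> g x), smult = (\<lambda>c f x. c \<otimes>\<^bsub>K\<^esub> f x)\<rparr>"

definition basis_vec :: "('k, 'r) ring_scheme \<Rightarrow> 'x \<Rightarrow> 'x \<Rightarrow> 'k"
  where "basis_vec K x = (\<lambda>y. if y = x then \<one>\<^bsub>K\<^esub> else \<zero>\<^bsub>K\<^esub>)"

definition quotient_space ::
  "('k, 'a, 'm) module_scheme \<Rightarrow> 'a set \<Rightarrow> ('k, 'a set) module"
  where "quotient_space V N =
    \<lparr>carrier = a_rcosets\<^bsub>V\<^esub> N, mult = (\<lambda>A B. N), one = N, zero = N,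
     add = (\<lambda>A B. A <+>\<^bsub>V\<^esub> B), smult = (\<lambda>c A. \<Union>a\<in>A. N +>\<^bsub>V\<^esub> (c \<odot>\<^bsub>V\<^esub> a))\<rparr>"

definition bilinear_relations ::
  "('k, 'r) ring_scheme \<Rightarrow> ('k, 'a, 'm) module_scheme \<Rightarrow> ('k, 'b, 'n) module_scheme
    \<Rightarrow> ('a \<times> 'b \<Rightarrow> 'k) set"
  where "bilinear_relations K V W =
    (let F = free_space K (carrier V \<times> carrier W); \<delta> = (\<lambda>x y. basis_vec K (x, y)) in
      {\<delta> (x \<oplus>\<^bsub>V\<^esub> x') y \<ominus>\<^bsub>F\<^esub> (\<delta> x y \<oplus>\<^bsub>F\<^esub> \<delta> x' y) | x x' y.
         x \<in> carrier V \<and> x' \<in> carrier V \<and> y \<in> carrier W} \<union>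
      {\<delta> x (y \<oplus>\<^bsub>W\<^esub> y') \<ominus>\<^bsub>F\<^esub> (\<delta> x y \<oplus>\<^bsub>F\<^esub> \<delta> x y') | x y y'.
         x \<in> carrier V \<and> y \<in> carrier W \<and> y' \<in> carrier W} \<union>
      {\<delta> (c \<odot>\<^bsub>V\<^esub> x) y \<ominus>\<^bsub>F\<^esub> c \<odot>\<^bsub>F\<^esub> \<delta> x y | c x y.
         c \<in> carrier K \<and> x \<in> carrier V \<and> y \<in> carrier W} \<union>
      {\<delta> x (c \<odot>\<^bsub>W\<^esub> y) \<ominus>\<^bsub>F\<^esub> c \<odot>\<^bsub>F\<^esub> \<delta> x y | c x y.
         c \<in> carrier K \<and> x \<in> carrier V \<and> y \<in> carrier W})"

definition tensor_rel ::
  "('k, 'r) ring_scheme \<Rightarrow> ('k, 'a, 'm) module_scheme \<Rightarrow> ('k, 'b, 'n) module_scheme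
    \<Rightarrow> ('a \<times> 'b \<Rightarrow> 'k) set"
  where "tensor_rel K V W =
    LinearCombinations.module.span K (free_space K (carrier V \<times> carrier W)) (bilinear_relations K V W)"

definition tensor_space ::
  "('k, 'r) ring_scheme \<Rightarrow> ('k, 'a, 'm) module_scheme \<Rightarrow> ('k, 'b, 'n) module_scheme
    \<Rightarrow> ('k, ('a \<times> 'b \<Rightarrow> 'k) set) module"
  where "tensor_space K V W =
    quotient_space (free_space K (carrier V \<times> carrier W)) (tensor_rel K V W)"

definition tensor ::
  "('k, 'r) ring_scheme \<Rightarrow> ('k, 'a, 'm) module_scheme \<Rightarrow> ('k, 'b, 'n) module_scheme
    \<Rightarrow> 'a \<Rightarrow> 'b \<Rightarrow> ('a \<times> 'b \<Rightarrow> 'k) set"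
  where "tensor K V W x y =
    tensor_rel K V W +>\<^bsub>free_space K (carrier V \<times> carrier W)\<^esub> basis_vec K (x, y)"

definition ext_rel ::
  "('k, 'r) ring_scheme \<Rightarrow> ('k, 'a, 'm) module_scheme \<Rightarrow> ('a \<times> 'a \<Rightarrow> 'k) set"
  where "ext_rel K V =
    LinearCombinations.module.span K (free_space K (carrier V \<times> carrier V))
      (bilinear_relations K V V \<union> {basis_vec K (x, x) | x. x \<in> carrier V})"

definition ext_square ::
  "('k, 'r) ring_scheme \<Rightarrow> ('k, 'a, 'm) module_scheme \<Rightarrow> ('k, ('a \<times> 'a \<Rightarrow> 'k) set) module"
  where "ext_square K V = quotient_space (free_space K (carrier V \<times> carrier V)) (ext_rel K V)"

definition wedge ::
  "('k, 'r) ring_scheme \<Rightarrow> ('k, 'a, 'm) module_scheme \<Rightarrow> 'a \<Rightarrow> 'a \<Rightarrow> ('a \<times> 'a \<Rightarrow> 'k) set"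
  where "wedge K V x y =
    ext_rel K V +>\<^bsub>free_space K (carrier V \<times> carrier V)\<^esub> basis_vec K (x, y)"


section \<open>The extension of 3-Lie algebras\<close>

text \<open>\<open>rho\<close>, \<open>nu\<close>, \<open>omega\<close> are the uncurried linear maps from the second exterior power of \<open>G\<close>
  to the endomorphisms of \<open>H\<close>, from \<open>G\<close> to the linear maps from the second exterior power of \<open>H\<close>
  to \<open>H\<close>, and from the third exterior power of \<open>G\<close> to \<open>H\<close>.\<close>

definition extension_data ::
  "('k, 'r) ring_scheme \<Rightarrow> ('k, 'g, 'm) module_scheme \<Rightarrow> ('k, 'h, 'n) module_scheme
    \<Rightarrow> ('g \<Rightarrow> 'g \<Rightarrow> 'h \<Rightarrow> 'h) \<Rightarrow> ('g \<Rightarrow> 'h \<Rightarrow> 'h \<Rightarrow> 'h) \<Rightarrow> ('g \<Rightarrow> 'g \<Rightarrow> 'g \<Rightarrow> 'h) \<Rightarrow> bool"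
  where "extension_data K G H rho nu omega \<longleftrightarrow>
    trilinear K G G H H rho \<and> (\<forall>x\<in>carrier G. \<forall>v\<in>carrier H. rho x x v = \<zero>\<^bsub>H\<^esub>) \<and>
    trilinear K G H H H nu \<and> (\<forall>x\<in>carrier G. \<forall>v\<in>carrier H. nu x v v = \<zero>\<^bsub>H\<^esub>) \<and>
    alternating_trilinear K G H omega"

text \<open>The pair \<open>(x, v)\<close> in \<open>direct_sum G H\<close> is the element \<open>x + v\<close>.\<close>

definition ext_bracket ::
  "('k, 'g, 'm) module_scheme \<Rightarrow> ('g \<Rightarrow> 'g \<Rightarrow> 'g \<Rightarrow> 'g)
    \<Rightarrow> ('k, 'h, 'n) module_scheme \<Rightarrow> ('h \<Rightarrow> 'h \<Rightarrow> 'h \<Rightarrow> 'h)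
    \<Rightarrow> ('g \<Rightarrow> 'g \<Rightarrow> 'h \<Rightarrow> 'h) \<Rightarrow> ('g \<Rightarrow> 'h \<Rightarrow> 'h \<Rightarrow> 'h) \<Rightarrow> ('g \<Rightarrow> 'g \<Rightarrow> 'g \<Rightarrow> 'h)
    \<Rightarrow> 'g \<times> 'h \<Rightarrow> 'g \<times> 'h \<Rightarrow> 'g \<times> 'h \<Rightarrow> 'g \<times> 'h"
  where "ext_bracket G brG H brH rho nu omega = (\<lambda>(x1, v1) (x2, v2) (x3, v3).
    (brG x1 x2 x3,
     omega x1 x2 x3 \<oplus>\<^bsub>H\<^esub> rho x1 x2 v3 \<oplus>\<^bsub>H\<^esub> rho x2 x3 v1 \<oplus>\<^bsub>H\<^esub> rho x3 x1 v2
       \<oplus>\<^bsub>H\<^esub> nu x1 v2 v3 \<oplus>\<^bsub>H\<^esub> nu x2 v3 v1 \<oplus>\<^bsub>H\<^esub> nu x3 v1 v2 \<oplus>\<^bsub>H\<^esub> brH v1 v2 v3))"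


section \<open>The Leibniz algebras of fundamental objects\<close>

text \<open>The maps below are given by their values on decomposable elements. These span, so a
  (bi)linear map is determined on the carrier by such values, and the choice operator only fixes
  the irrelevant values outside the carrier.\<close>

definition fundamental_bracket ::
  "('k, 'r) ring_scheme \<Rightarrow> ('k, 'a, 'm) module_scheme \<Rightarrow> ('a \<Rightarrow> 'a \<Rightarrow> 'a \<Rightarrow> 'a)
    \<Rightarrow> ('a \<times> 'a \<Rightarrow> 'k) set \<Rightarrow> ('a \<times> 'a \<Rightarrow> 'k) set \<Rightarrow> ('a \<times> 'a \<Rightarrow> 'k) set"
  where "fundamental_bracket K V br = (SOME B.
    bilinear K (ext_square K V) (ext_square K V) (ext_square K V) B \<and>
    (\<forall>x1\<in>carrier V. \<forall>x2\<in>carrier V. \<forall>y1\<in>carrier V. \<forall>y2\<in>carrier V.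
      B (wedge K V x1 x2) (wedge K V y1 y2) =
        wedge K V (br x1 x2 y1) y2 \<oplus>\<^bsub>ext_square K V\<^esub> wedge K V y1 (br x1 x2 y2)))"

abbreviation kernel_space ::
  "('k, 'r) ring_scheme \<Rightarrow> ('k, 'g, 'm) module_scheme \<Rightarrow> ('k, 'h, 'n) module_scheme
    \<Rightarrow> ('k, ('h \<times> 'h \<Rightarrow> 'k) set \<times> ('g \<times> 'h \<Rightarrow> 'k) set) module"
  where "kernel_space K G H \<equiv> direct_sum (ext_square K H) (tensor_space K G H)"

definition kernel_bracket ::
  "('k, 'r) ring_scheme \<Rightarrow> ('k, 'g, 'm) module_scheme
    \<Rightarrow> ('k, 'h, 'n) module_scheme \<Rightarrow> ('h \<Rightarrow> 'h \<Rightarrow> 'h \<Rightarrow> 'h)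
    \<Rightarrow> ('g \<Rightarrow> 'g \<Rightarrow> 'h \<Rightarrow> 'h) \<Rightarrow> ('g \<Rightarrow> 'h \<Rightarrow> 'h \<Rightarrow> 'h)
    \<Rightarrow> ('h \<times> 'h \<Rightarrow> 'k) set \<times> ('g \<times> 'h \<Rightarrow> 'k) set
    \<Rightarrow> ('h \<times> 'h \<Rightarrow> 'k) set \<times> ('g \<times> 'h \<Rightarrow> 'k) set
    \<Rightarrow> ('h \<times> 'h \<Rightarrow> 'k) set \<times> ('g \<times> 'h \<Rightarrow> 'k) set"
  where "kernel_bracket K G H brH rho nu = (SOME B.
    bilinear K (kernel_space K G H) (kernel_space K G H) (kernel_space K G H) B \<and>
    (\<forall>u1\<in>carrier H. \<forall>v1\<in>carrier H. \<forall>x1\<in>carrier G. \<forall>w1\<in>carrier H.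
     \<forall>u2\<in>carrier H. \<forall>v2\<in>carrier H. \<forall>x2\<in>carrier G. \<forall>w2\<in>carrier H.
      B (wedge K H u1 v1, tensor K G H x1 w1) (wedge K H u2 v2, tensor K G H x2 w2) =
        (wedge K H (brH u1 v1 u2) v2
           \<oplus>\<^bsub>ext_square K H\<^esub> wedge K H u2 (brH u1 v1 v2)
           \<oplus>\<^bsub>ext_square K H\<^esub> wedge K H (nu x2 u1 v1) w2
           \<oplus>\<^bsub>ext_square K H\<^esub> wedge K H (nu x1 w1 u2) v2
           \<oplus>\<^bsub>ext_square K H\<^esub> wedge K H u2 (nu x1 w1 v2)
           \<ominus>\<^bsub>ext_square K H\<^esub> wedge K H (rho x1 x2 w1) w2,
         tensor K G H x2 (brH u1 v1 w2)
           \<oplus>\<^bsub>tensor_space K G H\<^esub> tensor K G H x2 (nu x1 w1 w2))))"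

text \<open>The inclusion and the projection under the identification of
  \<open>ext_square K (direct_sum G H)\<close> with
  \<open>direct_sum (kernel_space K G H) (ext_square K G)\<close>, in which \<open>tensor K G H x w\<close> corresponds to
  the wedge of \<open>x\<close> and \<open>w\<close>.\<close>

definition kernel_inclusion ::
  "('k, 'r) ring_scheme \<Rightarrow> ('k, 'g, 'm) module_scheme \<Rightarrow> ('k, 'h, 'n) module_scheme
    \<Rightarrow> ('h \<times> 'h \<Rightarrow> 'k) set \<times> ('g \<times> 'h \<Rightarrow> 'k) set \<Rightarrow> (('g \<times> 'h) \<times> ('g \<times> 'h) \<Rightarrow> 'k) set"
  where "kernel_inclusion K G H = (SOME f.
    f \<in> module_hom K (kernel_space K G H) (ext_square K (direct_sum G H)) \<and>
    (\<forall>u\<in>carrier H. \<forall>v\<in>carrier H. \<forall>x\<in>carrier G. \<forall>w\<in>carrier H.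
      f (wedge K H u v, tensor K G H x w) =
        wedge K (direct_sum G H) (\<zero>\<^bsub>G\<^esub>, u) (\<zero>\<^bsub>G\<^esub>, v)
          \<oplus>\<^bsub>ext_square K (direct_sum G H)\<^esub> wedge K (direct_sum G H) (x, \<zero>\<^bsub>H\<^esub>) (\<zero>\<^bsub>G\<^esub>, w)))"

definition ext_square_projection ::
  "('k, 'r) ring_scheme \<Rightarrow> ('k, 'g, 'm) module_scheme \<Rightarrow> ('k, 'h, 'n) module_scheme
    \<Rightarrow> (('g \<times> 'h) \<times> ('g \<times> 'h) \<Rightarrow> 'k) set \<Rightarrow> ('g \<times> 'g \<Rightarrow> 'k) set"
  where "ext_square_projection K G H = (SOME f.
    f \<in> module_hom K (ext_square K (direct_sum G H)) (ext_square K G) \<and>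
    (\<forall>x\<in>carrier G. \<forall>u\<in>carrier H. \<forall>y\<in>carrier G. \<forall>v\<in>carrier H.
      f (wedge K (direct_sum G H) (x, u) (y, v)) = wedge K G x y))"

end

theory Submission
  imports Defs
begin

text \<open>Write \<open>E = G \<oplus> H\<close>. The wedge of \<open>(x, u)\<close> and \<open>(y, v)\<close> is sent to
  \<open>(u \<and> v, x \<otimes> v - y \<otimes> u)\<close> by a linear map \<open>r\<close> from the exterior square of \<open>E\<close> to the kernel
  space; together with the inclusion \<open>i\<close> of the kernel space, the projection \<open>p\<close> onto the exterior
  square of \<open>G\<close> and the section \<open>s\<close> of \<open>p\<close> induced by \<open>x \<mapsto> (x, 0)\<close> it splits the sequence:
  \<open>r i = 1\<close>, \<open>p s = 1\<close>, \<open>p i = 0\<close> and \<open>i r + s p = 1\<close>. On decomposable elements \<open>r [i a, i b]\<close>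
  is the formula for \<open>{a, b}\<close>, so the two brackets agree everywhere. As \<open>p\<close> is a morphism of Leibniz
  algebras, its kernel is a subalgebra, hence \<open>i {a, b} = [i a, i b]\<close>, and the Leibniz identity
  for \<open>{\<cdot>, \<cdot>}\<close> follows from injectivity of \<open>i\<close>.\<close>


section \<open>Homomorphisms and direct sums of modules\<close>

text \<open>The maps involved live on cosets of free modules and are specified only on decomposable
  elements, through a choice operator. Hence each of them needs an existence proof by a universal
  property, and each identity is checked on decomposables and then extended one argument at a time,
  both sides being linear in each argument. The obstacle is \<open>kernel_bracket\<close>. Taken
  directly, its eight-term formula would have to be shown well defined on wedges and tensors, and
  its Leibniz identity would require unpacking the compatibility conditions on \<open>rho\<close>,
  \<open>nu\<close> and \<open>omega\<close> that are hidden in the 3-Lie identity of G \<oplus> H.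
  Transport along a linear splitting avoids both: r [i a, i b] is bilinear by construction, which
  settles existence, and the Leibniz identity is inherited from the ambient bracket. The map r is
  read off from (x + u) \<and> (y + v) = x \<and> y + x \<and> v - y \<and> u + u \<and> v by
  dropping the term x \<and> y.\<close>

lemma (in abelian_group) a_inv_zero: "\<ominus> \<zero> = \<zero>"
  by (rule minus_equality) simp_all

lemma module_homI:
  assumes "\<And>x. x \<in> carrier M \<Longrightarrow> f x \<in> carrier N"
    and "\<And>x y. x \<in> carrier M \<Longrightarrow> y \<in> carrier M \<Longrightarrow> f (x \<oplus>\<^bsub>M\<^esub> y) = f x \<oplus>\<^bsub>N\<^esub> f y"
    and "\<And>c x. c \<in> carrier R \<Longrightarrow> x \<in> carrier M \<Longrightarrow> f (c \<odot>\<^bsub>M\<^esub> x) = c \<odot>\<^bsub>N\<^esub> f x"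
  shows "f \<in> module_hom R M N"
  using assms by (auto simp: LinearCombinations.module_hom_def)

lemma module_hom_carrier: "f \<in> module_hom R M N \<Longrightarrow> x \<in> carrier M \<Longrightarrow> f x \<in> carrier N"
  by (auto simp: LinearCombinations.module_hom_def)

lemma module_hom_comp:
  assumes "f \<in> module_hom R M N" "g \<in> module_hom R N P"
  shows "(\<lambda>x. g (f x)) \<in> module_hom R M P"
  using assms by (auto simp: LinearCombinations.module_hom_def Pi_iff)

lemma mod_hom_if_module_hom:
  "module R M \<Longrightarrow> module R N \<Longrightarrow> f \<in> module_hom R M N \<Longrightarrow> mod_hom R M N f"
  by (simp add: mod_hom_def mod_hom_axioms_def)

lemma module_hom_zero:
  "module R M \<Longrightarrow> module R N \<Longrightarrow> f \<in> module_hom R M N \<Longrightarrow> f \<zero>\<^bsub>M\<^esub> = \<zero>\<^bsub>N\<^esub>"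
  using mod_hom.f0_is_0[OF mod_hom_if_module_hom] .

lemma module_hom_minus:
  "module R M \<Longrightarrow> module R N \<Longrightarrow> f \<in> module_hom R M N \<Longrightarrow> x \<in> carrier M \<Longrightarrow> y \<in> carrier M
    \<Longrightarrow> f (x \<ominus>\<^bsub>M\<^esub> y) = f x \<ominus>\<^bsub>N\<^esub> f y"
  using mod_hom.f_minus[OF mod_hom_if_module_hom] .

lemma module_hom_a_inv:
  "module R M \<Longrightarrow> module R N \<Longrightarrow> f \<in> module_hom R M N \<Longrightarrow> x \<in> carrier M
    \<Longrightarrow> f (\<ominus>\<^bsub>M\<^esub> x) = \<ominus>\<^bsub>N\<^esub> f x"
  using mod_hom.f_neg[OF mod_hom_if_module_hom] .

lemma module_hom_add_fun:
  assumes "module R N" "f \<in> module_hom R M N" "g \<in> module_hom R M N"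
  shows "(\<lambda>x. f x \<oplus>\<^bsub>N\<^esub> g x) \<in> module_hom R M N"
proof -
  interpret N: Module.module R N by fact
  show ?thesis
    using assms(2,3) by (auto simp: LinearCombinations.module_hom_def Pi_iff N.a_ac N.smult_r_distr)
qed

lemma module_hom_minus_fun:
  assumes "module R N" "f \<in> module_hom R M N" "g \<in> module_hom R M N"
  shows "(\<lambda>x. f x \<ominus>\<^bsub>N\<^esub> g x) \<in> module_hom R M N"
proof -
  interpret N: Module.module R N by fact
  show ?thesis
    using assms(2,3)
    by (auto simp: LinearCombinations.module_hom_def Pi_iff a_minus_def N.minus_add N.a_ac N.smult_r_distr N.smult_r_minus)
qed

lemma module_hom_smult_fun:
  assumes "module R N" "c \<in> carrier R" "f \<in> module_hom R M N"
  shows "(\<lambda>x. c \<odot>\<^bsub>N\<^esub> f x) \<in> module_hom R M N"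
proof -
  interpret N: Module.module R N by fact
  show ?thesis
    using assms(2,3)
    by (auto simp: LinearCombinations.module_hom_def Pi_iff N.smult_r_distr
        N.smult_assoc1[symmetric] N.m_comm)
qed

lemma module_hom_Pair:
  assumes "f \<in> module_hom R M N" "g \<in> module_hom R M P"
  shows "(\<lambda>x. (f x, g x)) \<in> module_hom R M (direct_sum N P)"
  using assms by (auto simp: LinearCombinations.module_hom_def direct_sum_def)

lemma module_hom_fst: "fst \<in> module_hom R (direct_sum M N) M"
  and module_hom_snd: "snd \<in> module_hom R (direct_sum M N) N"
  by (auto simp: LinearCombinations.module_hom_def direct_sum_def)

lemma module_hom_zero_fun:
  assumes "module R N" shows "(\<lambda>x. \<zero>\<^bsub>N\<^esub>) \<in> module_hom R M N"
proof -
  interpret N: Module.module R N by fact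
  show ?thesis by (auto simp: LinearCombinations.module_hom_def)
qed

lemma module_hom_id: "(\<lambda>x. x) \<in> module_hom R M M"
  by (simp add: module_homI)

lemma direct_sum_sel [simp]:
  "carrier (direct_sum M N) = carrier M \<times> carrier N"
  "\<zero>\<^bsub>direct_sum M N\<^esub> = (\<zero>\<^bsub>M\<^esub>, \<zero>\<^bsub>N\<^esub>)"
  "(x, u) \<oplus>\<^bsub>direct_sum M N\<^esub> (y, v) = (x \<oplus>\<^bsub>M\<^esub> y, u \<oplus>\<^bsub>N\<^esub> v)"
  "c \<odot>\<^bsub>direct_sum M N\<^esub> (x, u) = (c \<odot>\<^bsub>M\<^esub> x, c \<odot>\<^bsub>N\<^esub> u)"
  by (simp_all add: direct_sum_def)

lemma module_hom_inj1: "module K M \<Longrightarrow> module K N \<Longrightarrow> (\<lambda>x. (x, \<zero>\<^bsub>N\<^esub>)) \<in> module_hom K M (direct_sum M N)"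
  and module_hom_inj2: "module K M \<Longrightarrow> module K N \<Longrightarrow> (\<lambda>u. (\<zero>\<^bsub>M\<^esub>, u)) \<in> module_hom K N (direct_sum M N)"
  by (rule module_hom_Pair; simp add: module_hom_id module_hom_zero_fun)+

lemma direct_sum_hom_eqI:
  assumes M: "module K M" and N: "module K N"
    and f: "f \<in> module_hom K (direct_sum M N) P" and g: "g \<in> module_hom K (direct_sum M N) P"
    and eq1: "\<And>a. a \<in> carrier M \<Longrightarrow> f (a, \<zero>\<^bsub>N\<^esub>) = g (a, \<zero>\<^bsub>N\<^esub>)"
    and eq2: "\<And>b. b \<in> carrier N \<Longrightarrow> f (\<zero>\<^bsub>M\<^esub>, b) = g (\<zero>\<^bsub>M\<^esub>, b)"
    and z: "z \<in> carrier (direct_sum M N)"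
  shows "f z = g z"
proof -
  interpret M: Module.module K M by fact
  interpret N: Module.module K N by fact
  obtain a b where ab: "z = (a, b)" "a \<in> carrier M" "b \<in> carrier N" using z by auto
  then have z_eq: "z = (a, \<zero>\<^bsub>N\<^esub>) \<oplus>\<^bsub>direct_sum M N\<^esub> (\<zero>\<^bsub>M\<^esub>, b)" by simp
  have cl: "(a, \<zero>\<^bsub>N\<^esub>) \<in> carrier (direct_sum M N)" "(\<zero>\<^bsub>M\<^esub>, b) \<in> carrier (direct_sum M N)"
    using ab by auto
  show ?thesis
    unfolding z_eq LinearCombinations.module_hom_add[OF f cl] LinearCombinations.module_hom_add[OF g cl]
    using ab eq1 eq2 by simp
qed


section \<open>Free modules\<close>

lemma free_space_sel:
  "carrier (free_space K B) =
    {f. (\<forall>x. f x \<in> carrier K) \<and> finite {x. f x \<noteq> \<zero>\<^bsub>K\<^esub>} \<and> {x. f x \<noteq> \<zero>\<^bsub>K\<^esub>} \<subseteq> B}"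
  "zero (free_space K B) = (\<lambda>x. \<zero>\<^bsub>K\<^esub>)"
  "add (free_space K B) = (\<lambda>f g x. f x \<oplus>\<^bsub>K\<^esub> g x)"
  "smult (free_space K B) = (\<lambda>c f x. c \<otimes>\<^bsub>K\<^esub> f x)"
  by (simp_all add: free_space_def)

context cring
begin

context
  notes free_space_sel [simp]
begin

lemma free_space_add_closed:
  assumes "f \<in> carrier (free_space R B)" "g \<in> carrier (free_space R B)"
  shows "f \<oplus>\<^bsub>free_space R B\<^esub> g \<in> carrier (free_space R B)"
proof -
  have "{x. f x \<oplus> g x \<noteq> \<zero>} \<subseteq> {x. f x \<noteq> \<zero>} \<union> {x. g x \<noteq> \<zero>}" by auto
  with assms show ?thesis by (auto intro: finite_subset)
qed

lemma free_space_smult_closed: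
  assumes "c \<in> carrier R" "f \<in> carrier (free_space R B)"
  shows "c \<odot>\<^bsub>free_space R B\<^esub> f \<in> carrier (free_space R B)"
proof -
  have "{x. c \<otimes> f x \<noteq> \<zero>} \<subseteq> {x. f x \<noteq> \<zero>}" using assms by auto
  with assms show ?thesis by (auto intro: finite_subset)
qed

lemma free_space_module: "module R (free_space R B)"
proof (rule moduleI)
  show "abelian_group (free_space R B)"
  proof (rule abelian_groupI)
    fix f assume f: "f \<in> carrier (free_space R B)"
    have "{x. \<ominus> f x \<noteq> \<zero>} \<subseteq> {x. f x \<noteq> \<zero>}" by auto
    with f have "(\<lambda>x. \<ominus> f x) \<in> carrier (free_space R B)" by (auto intro: finite_subset)
    with f show "\<exists>g\<in>carrier (free_space R B). g \<oplus>\<^bsub>free_space R B\<^esub> f = \<zero>\<^bsub>free_space R B\<^esub>"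
      by (intro bexI[of _ "\<lambda>x. \<ominus> f x"]) (auto simp: l_neg)
  qed (use free_space_add_closed in \<open>auto simp: fun_eq_iff a_ac\<close>)
  show "c \<odot>\<^bsub>free_space R B\<^esub> x \<in> carrier (free_space R B)"
    if "c \<in> carrier R" "x \<in> carrier (free_space R B)" for c x
    using free_space_smult_closed[OF that] .
qed (auto simp: cring_axioms fun_eq_iff l_distr r_distr m_assoc)

lemma basis_vec_closed: "x \<in> B \<Longrightarrow> basis_vec R x \<in> carrier (free_space R B)"
  by (auto simp: basis_vec_def split: if_splits)

text \<open>Finite support allows peeling off one point at a time: f is f x times the basis vector
  at x plus \<open>f(x := \<zero>)\<close>.\<close>

lemma free_space_induct [consumes 1, case_names zero add smult basis]:
  assumes "f \<in> carrier (free_space R B)"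
    and zero: "P \<zero>\<^bsub>free_space R B\<^esub>"
    and add: "\<And>f g. f \<in> carrier (free_space R B) \<Longrightarrow> g \<in> carrier (free_space R B)
      \<Longrightarrow> P f \<Longrightarrow> P g \<Longrightarrow> P (f \<oplus>\<^bsub>free_space R B\<^esub> g)"
    and smult: "\<And>c f. c \<in> carrier R \<Longrightarrow> f \<in> carrier (free_space R B)
      \<Longrightarrow> P f \<Longrightarrow> P (c \<odot>\<^bsub>free_space R B\<^esub> f)"
    and basis: "\<And>x. x \<in> B \<Longrightarrow> P (basis_vec R x)"
  shows "P f"
proof -
  \<comment> \<open>The induction runs over a finite set that contains the support, not over the
    support itself, so the inserted point may have coefficient zero.\<close>
  have "P f" if "finite S" "S \<subseteq> B" "f \<in> carrier (free_space R B)" "{x. f x \<noteq> \<zero>} \<subseteq> S" for f S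
    using that
  proof (induction S arbitrary: f rule: finite_induct)
    case empty
    then have "f = \<zero>\<^bsub>free_space R B\<^esub>" by auto
    with zero show ?case by simp
  next
    case (insert x S)
    define g where "g = f(x := \<zero>)"
    have supp: "{y. g y \<noteq> \<zero>} \<subseteq> {y. f y \<noteq> \<zero>}" by (auto simp: g_def)
    then have g: "g \<in> carrier (free_space R B)"
      using insert.prems(2) by (auto simp: g_def intro: finite_subset)
    have Pg: "P g" using insert.prems insert.hyps g by (intro insert.IH) (auto simp: g_def)
    have b: "basis_vec R x \<in> carrier (free_space R B)" "P (basis_vec R x)" "f x \<in> carrier R"
      using insert.prems basis basis_vec_closed[of x B] by auto
    have "f = f x \<odot>\<^bsub>free_space R B\<^esub> basis_vec R x \<oplus>\<^bsub>free_space R B\<^esub> g"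
      using insert.prems(2) by (auto simp: fun_eq_iff g_def basis_vec_def)
    moreover have "P (f x \<odot>\<^bsub>free_space R B\<^esub> basis_vec R x \<oplus>\<^bsub>free_space R B\<^esub> g)"
      using b g Pg by (intro add smult free_space_smult_closed)
    ultimately show ?case by simp
  qed
  then show ?thesis using assms(1) by auto
qed

text \<open>The extension is forced: f goes to the sum of f x times \<phi> x over its
  support.\<close>

lemma free_space_lift:
  assumes "module R M" and \<phi>: "\<phi> \<in> B \<rightarrow> carrier M"
  shows "\<exists>h\<in>module_hom R (free_space R B) M. \<forall>x\<in>B. h (basis_vec R x) = \<phi> x"
proof -
  interpret M: Module.module R M by fact
  define h where "h f = (\<Oplus>\<^bsub>M\<^esub>x\<in>{x. f x \<noteq> \<zero>}. f x \<odot>\<^bsub>M\<^esub> \<phi> x)" for f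
  \<comment> \<open>Supports shrink under cancellation, so the supports of f, g and their sum
    differ. Summing over any larger finite set gives the same value, which lets all three sums share
    one index set.\<close>
  have h_eq: "h f = (\<Oplus>\<^bsub>M\<^esub>x\<in>S. f x \<odot>\<^bsub>M\<^esub> \<phi> x)"
    if "f \<in> carrier (free_space R B)" "finite S" "S \<subseteq> B" "{x. f x \<noteq> \<zero>} \<subseteq> S" for f S
    unfolding h_def using that \<phi>
    by (intro M.add.finprod_mono_neutral_cong_left) (auto simp: Pi_iff subset_iff)
  have in_M: "f x \<odot>\<^bsub>M\<^esub> \<phi> x \<in> carrier M"
    if "f \<in> carrier (free_space R B)" "x \<in> B" for f x using that \<phi> by auto
  have "h \<in> module_hom R (free_space R B) M"
  proof (rule module_homI)
    show "h f \<in> carrier M" if "f \<in> carrier (free_space R B)" for f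
      unfolding h_def using that in_M[OF that] by (intro M.finsum_closed) auto
  next
    fix f g assume f: "f \<in> carrier (free_space R B)" and g: "g \<in> carrier (free_space R B)"
    define S where "S = {x. f x \<noteq> \<zero>} \<union> {x. g x \<noteq> \<zero>}"
    have S: "finite S" "S \<subseteq> B" using f g by (auto simp: S_def)
    have "h (f \<oplus>\<^bsub>free_space R B\<^esub> g) = (\<Oplus>\<^bsub>M\<^esub>x\<in>S. (f x \<oplus> g x) \<odot>\<^bsub>M\<^esub> \<phi> x)"
      by (subst h_eq[OF free_space_add_closed[OF f g] S]) (auto simp: S_def)
    also have "\<dots> = (\<Oplus>\<^bsub>M\<^esub>x\<in>S. f x \<odot>\<^bsub>M\<^esub> \<phi> x \<oplus>\<^bsub>M\<^esub> g x \<odot>\<^bsub>M\<^esub> \<phi> x)"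
      using f g S \<phi> by (intro M.finsum_cong') (auto simp: M.smult_l_distr Pi_iff subset_iff)
    also have "\<dots> = (\<Oplus>\<^bsub>M\<^esub>x\<in>S. f x \<odot>\<^bsub>M\<^esub> \<phi> x) \<oplus>\<^bsub>M\<^esub> (\<Oplus>\<^bsub>M\<^esub>x\<in>S. g x \<odot>\<^bsub>M\<^esub> \<phi> x)"
      using in_M[OF f] in_M[OF g] S by (intro M.finsum_addf) auto
    also have "\<dots> = h f \<oplus>\<^bsub>M\<^esub> h g"
      using h_eq[OF f S] h_eq[OF g S] by (auto simp: S_def)
    finally show "h (f \<oplus>\<^bsub>free_space R B\<^esub> g) = h f \<oplus>\<^bsub>M\<^esub> h g" .
  next
    fix c f assume c: "c \<in> carrier R" and f: "f \<in> carrier (free_space R B)"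
    let ?S = "{x. f x \<noteq> \<zero>}"
    have S: "finite ?S" "?S \<subseteq> B" using f by auto
    have "h (c \<odot>\<^bsub>free_space R B\<^esub> f) = (\<Oplus>\<^bsub>M\<^esub>x\<in>?S. (c \<otimes> f x) \<odot>\<^bsub>M\<^esub> \<phi> x)"
      by (subst h_eq[OF free_space_smult_closed[OF c f] S]) (use c in auto)
    also have "\<dots> = (\<Oplus>\<^bsub>M\<^esub>x\<in>?S. c \<odot>\<^bsub>M\<^esub> (f x \<odot>\<^bsub>M\<^esub> \<phi> x))"
      using c f S \<phi> by (intro M.finsum_cong') (auto simp: M.smult_assoc1 Pi_iff subset_iff)
    also have "\<dots> = c \<odot>\<^bsub>M\<^esub> h f"
      unfolding h_def using in_M[OF f] S c by (intro M.finsum_smult_ldistr[symmetric]) auto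
    finally show "h (c \<odot>\<^bsub>free_space R B\<^esub> f) = c \<odot>\<^bsub>M\<^esub> h f" .
  qed
  moreover have "h (basis_vec R x) = \<phi> x" if "x \<in> B" for x
  proof -
    have "h (basis_vec R x) = (\<Oplus>\<^bsub>M\<^esub>y\<in>{x}. basis_vec R x y \<odot>\<^bsub>M\<^esub> \<phi> y)"
      using that by (intro h_eq basis_vec_closed) (auto simp: basis_vec_def split: if_splits)
    also have "\<dots> = \<phi> x" using that \<phi> by (auto simp: basis_vec_def Pi_iff)
    finally show ?thesis .
  qed
  ultimately show ?thesis by blast
qed

end

end


section \<open>Quotient modules\<close>

lemma quotient_space_zero [simp]: "\<zero>\<^bsub>quotient_space M N\<^esub> = N"
  and quotient_space_carrier: "carrier (quotient_space M N) = (\<lambda>a. N +>\<^bsub>M\<^esub> a) ` carrier M"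
  by (auto simp: quotient_space_def A_RCOSETS_def RCOSETS_def a_r_coset_def)

context
  fixes R and M (structure) and N
  assumes M_mod: "module R M" and N_sub: "submodule R N M"
begin

interpretation M: Module.module R M by (rule M_mod)

interpretation N: abelian_subgroup N M
proof (rule abelian_subgroupI3)
  show "additive_subgroup N M"
  proof (rule additive_subgroupI, rule subgroup.intro)
    \<comment> \<open>A submodule is closed under negation because it is closed under multiplication
      by -1.\<close>
    have *: "\<ominus>\<^bsub>M\<^esub> x \<in> N" if "x \<in> N" for x
    proof -
      have "\<ominus>\<^bsub>M\<^esub> x = (\<ominus>\<^bsub>R\<^esub> \<one>\<^bsub>R\<^esub>) \<odot>\<^bsub>M\<^esub> x"
        using that submodule.subset[OF N_sub] by (simp add: M.smult_l_minus subset_iff)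
      then show ?thesis using that submodule.smult_closed[OF N_sub] by simp
    qed
    then show "inv\<^bsub>add_monoid M\<^esub> x \<in> N" if "x \<in> N" for x using that by (simp add: a_inv_def)
  qed (use N_sub in \<open>auto simp: submodule_def\<close>)
qed (rule M.abelian_group_axioms)

lemma quotient_add:
  "a \<in> carrier M \<Longrightarrow> b \<in> carrier M \<Longrightarrow>
    (N +> a) \<oplus>\<^bsub>quotient_space M N\<^esub> (N +> b) = N +> (a \<oplus> b)"
  by (simp add: N.a_rcos_sum quotient_space_def)

lemma quotient_eq_zero_iff: "a \<in> carrier M \<Longrightarrow> N +> a = N \<longleftrightarrow> a \<in> N"
  by (metis N.a_rcos_self N.a_rcos_const)

text \<open>The union in \<open>quotient_space\<close> ranges over all representatives of the coset.
  Two of them differ by some n in N, and c n is again in N, so every member of the union is the same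
  coset.\<close>

lemma quotient_smult:
  assumes "c \<in> carrier R" "a \<in> carrier M"
  shows "c \<odot>\<^bsub>quotient_space M N\<^esub> (N +> a) = N +> (c \<odot> a)"
proof -
  have "N +> (c \<odot> b) = N +> (c \<odot> a)" if "b \<in> N +> a" for b
  proof -
    obtain n where n: "n \<in> N" "b = n \<oplus> a" using \<open>b \<in> N +> a\<close> by (auto simp: a_r_coset_def')
    have "c \<odot> b = c \<odot> n \<oplus> c \<odot> a" using n assms by (simp add: M.smult_r_distr)
    moreover have "c \<odot> n \<in> N" using n assms submodule.smult_closed[OF N_sub] by simp
    ultimately have "c \<odot> b \<in> N +> (c \<odot> a)" by (auto simp: a_r_coset_def')
    then show ?thesis using assms by (metis N.a_repr_independence' M.smult_closed)
  qed
  moreover have "a \<in> N +> a" using assms by (simp add: N.a_rcos_self)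
  ultimately have "(\<Union>b\<in>N +> a. N +> (c \<odot> b)) = N +> (c \<odot> a)" by blast
  then show ?thesis by (simp add: quotient_space_def)
qed

lemma quotient_module: "module R (quotient_space M N)"
proof -
  note simps = quotient_add quotient_smult
  have zero: "N = N +> \<zero>" using quotient_eq_zero_iff[of \<zero>] by simp
  show ?thesis
  proof (rule moduleI)
    show "abelian_group (quotient_space M N)"
    proof (rule abelian_groupI, goal_cases)
      case (6 x)
      then obtain a where a: "a \<in> carrier M" "x = N +> a" by (auto simp: quotient_space_carrier)
      then have "(N +> (\<ominus> a)) \<oplus>\<^bsub>quotient_space M N\<^esub> x = N"
        using zero by (simp add: simps M.l_neg)
      with a show ?case by (auto simp: quotient_space_carrier)
    next
      case 2 show ?case using zero by (auto simp: quotient_space_carrier)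
    next
      case (5 x)
      then obtain a where a: "a \<in> carrier M" "x = N +> a" by (auto simp: quotient_space_carrier)
      then have "(N +> \<zero>) \<oplus>\<^bsub>quotient_space M N\<^esub> x = x"
        by (simp add: simps)
      with zero show ?case by simp
    qed (auto simp: quotient_space_carrier simps M.a_ac)
  qed (auto simp: quotient_space_carrier simps M.is_cring M.smult_l_distr M.smult_r_distr
        M.smult_assoc1)
qed

lemma quotient_map_hom: "(\<lambda>a. N +> a) \<in> module_hom R M (quotient_space M N)"
  by (rule module_homI) (auto simp: quotient_space_carrier quotient_add quotient_smult)

text \<open>Evaluating h at a chosen representative is independent of the choice, since h kills
  N.\<close>

lemma quotient_lift:
  assumes "module R P" and h: "h \<in> module_hom R M P" and ker: "\<And>n. n \<in> N \<Longrightarrow> h n = \<zero>\<^bsub>P\<^esub>"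
  shows "\<exists>g\<in>module_hom R (quotient_space M N) P. \<forall>a\<in>carrier M. g (N +> a) = h a"
proof -
  interpret P: Module.module R P by fact
  define g where "g A = h (SOME a. a \<in> A)" for A
  have g: "g (N +> a) = h a" if a: "a \<in> carrier M" for a
  proof -
    have "(SOME b. b \<in> N +> a) \<in> N +> a" using N.a_rcos_self[OF a] by (rule someI)
    then obtain n where n: "n \<in> N" "(SOME b. b \<in> N +> a) = n \<oplus> a" by (auto simp: a_r_coset_def')
    then have "g (N +> a) = h n \<oplus>\<^bsub>P\<^esub> h a"
      using a h LinearCombinations.module_hom_add[OF h] by (simp add: g_def)
    then show ?thesis using n a ker module_hom_carrier[OF h] by simp
  qed
  have "g \<in> module_hom R (quotient_space M N) P"
    using module_hom_carrier[OF h] LinearCombinations.module_hom_add[OF h] LinearCombinations.module_hom_smult[OF h]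
    by (intro module_homI) (auto simp: quotient_space_carrier g quotient_add quotient_smult)
  with g show ?thesis by blast
qed

end


section \<open>Bilinear maps\<close>

lemma bilinearI:
  assumes "\<And>x y. x \<in> carrier U \<Longrightarrow> y \<in> carrier V \<Longrightarrow> f x y \<in> carrier W"
    and "\<And>x x' y. x \<in> carrier U \<Longrightarrow> x' \<in> carrier U \<Longrightarrow> y \<in> carrier V \<Longrightarrow>
      f (x \<oplus>\<^bsub>U\<^esub> x') y = f x y \<oplus>\<^bsub>W\<^esub> f x' y"
    and "\<And>x y y'. x \<in> carrier U \<Longrightarrow> y \<in> carrier V \<Longrightarrow> y' \<in> carrier V \<Longrightarrow>
      f x (y \<oplus>\<^bsub>V\<^esub> y') = f x y \<oplus>\<^bsub>W\<^esub> f x y'"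
    and "\<And>c x y. c \<in> carrier K \<Longrightarrow> x \<in> carrier U \<Longrightarrow> y \<in> carrier V \<Longrightarrow>
      f (c \<odot>\<^bsub>U\<^esub> x) y = c \<odot>\<^bsub>W\<^esub> f x y"
    and "\<And>c x y. c \<in> carrier K \<Longrightarrow> x \<in> carrier U \<Longrightarrow> y \<in> carrier V \<Longrightarrow>
      f x (c \<odot>\<^bsub>V\<^esub> y) = c \<odot>\<^bsub>W\<^esub> f x y"
  shows "bilinear K U V W f"
  using assms by (auto simp: bilinear_def intro!: module_homI)

lemma
  assumes "bilinear K U V W f"
  shows bilinear_hom_right: "x \<in> carrier U \<Longrightarrow> (\<lambda>y. f x y) \<in> module_hom K V W"
    and bilinear_hom_left: "y \<in> carrier V \<Longrightarrow> (\<lambda>x. f x y) \<in> module_hom K U W"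
  using assms by (auto simp: bilinear_def)

lemma
  assumes "bilinear K U V W f" "x \<in> carrier U" "y \<in> carrier V"
  shows bilinear_closed: "f x y \<in> carrier W"
    and bilinear_add_left: "x' \<in> carrier U \<Longrightarrow> f (x \<oplus>\<^bsub>U\<^esub> x') y = f x y \<oplus>\<^bsub>W\<^esub> f x' y"
    and bilinear_add_right: "y' \<in> carrier V \<Longrightarrow> f x (y \<oplus>\<^bsub>V\<^esub> y') = f x y \<oplus>\<^bsub>W\<^esub> f x y'"
    and bilinear_smult_left: "c \<in> carrier K \<Longrightarrow> f (c \<odot>\<^bsub>U\<^esub> x) y = c \<odot>\<^bsub>W\<^esub> f x y"
    and bilinear_smult_right: "c \<in> carrier K \<Longrightarrow> f x (c \<odot>\<^bsub>V\<^esub> y) = c \<odot>\<^bsub>W\<^esub> f x y"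
  using bilinear_hom_right[OF assms(1,2)] bilinear_hom_left[OF assms(1,3)] assms(2,3)
  by (auto simp: LinearCombinations.module_hom_def)

lemma
  assumes "module K U" "module K V" "module K W" "bilinear K U V W f"
  shows bilinear_zero_left: "y \<in> carrier V \<Longrightarrow> f \<zero>\<^bsub>U\<^esub> y = \<zero>\<^bsub>W\<^esub>"
    and bilinear_zero_right: "x \<in> carrier U \<Longrightarrow> f x \<zero>\<^bsub>V\<^esub> = \<zero>\<^bsub>W\<^esub>"
    and bilinear_a_inv_left: "x \<in> carrier U \<Longrightarrow> y \<in> carrier V \<Longrightarrow> f (\<ominus>\<^bsub>U\<^esub> x) y = \<ominus>\<^bsub>W\<^esub> f x y"
  using module_hom_zero[OF assms(1,3) bilinear_hom_left[OF assms(4)]]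
    module_hom_zero[OF assms(2,3) bilinear_hom_right[OF assms(4)]]
    module_hom_a_inv[OF assms(1,3) bilinear_hom_left[OF assms(4)]]
  by auto

lemma bilinear_cong:
  assumes "module K U" "module K V" and f: "bilinear K U V W f"
    and eq: "\<And>x y. x \<in> carrier U \<Longrightarrow> y \<in> carrier V \<Longrightarrow> g x y = f x y"
  shows "bilinear K U V W g"
proof -
  interpret U: Module.module K U by fact
  interpret V: Module.module K V by fact
  show ?thesis
    by (rule bilinearI) (simp_all add: eq bilinear_closed[OF f] bilinear_add_left[OF f]
        bilinear_add_right[OF f] bilinear_smult_left[OF f] bilinear_smult_right[OF f])
qed

lemma bilinear_comp:
  assumes "bilinear K U V W f" "p \<in> module_hom K U' U" "q \<in> module_hom K V' V" "r \<in> module_hom K W W'"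
  shows "bilinear K U' V' W' (\<lambda>x y. r (f (p x) (q y)))"
  unfolding bilinear_def
  using module_hom_comp[OF module_hom_comp[OF assms(3) bilinear_hom_right[OF assms(1)]] assms(4)]
    module_hom_comp[OF module_hom_comp[OF assms(2) bilinear_hom_left[OF assms(1)]] assms(4)]
    module_hom_carrier[OF assms(2)] module_hom_carrier[OF assms(3)]
  by auto

text \<open>Polarization: expand f (x + y) (x + y) = 0; the two diagonal terms vanish and the two
  mixed ones must cancel.\<close>

lemma alternating_skew:
  assumes "module K V" "module K W" and f: "bilinear K V V W f"
    and alt: "\<And>x. x \<in> carrier V \<Longrightarrow> f x x = \<zero>\<^bsub>W\<^esub>"
    and x: "x \<in> carrier V" and y: "y \<in> carrier V"
  shows "f y x = \<ominus>\<^bsub>W\<^esub> f x y"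
proof -
  interpret V: Module.module K V by fact
  interpret W: Module.module K W by fact
  note cl = bilinear_closed[OF f]
  have "\<zero>\<^bsub>W\<^esub> = f (x \<oplus>\<^bsub>V\<^esub> y) (x \<oplus>\<^bsub>V\<^esub> y)" using alt x y by simp
  also have "\<dots> = f y x \<oplus>\<^bsub>W\<^esub> f x y"
    using x y by (simp add: alt[OF x] alt[OF y] bilinear_add_left[OF f] bilinear_add_right[OF f] cl W.a_ac)
  finally show ?thesis using x y cl by (metis W.minus_equality)
qed

lemma bilinear_add_fun:
  assumes W: "module K W" and f: "bilinear K U V W f" and g: "bilinear K U V W g"
  shows "bilinear K U V W (\<lambda>x y. f x y \<oplus>\<^bsub>W\<^esub> g x y)"
  unfolding bilinear_def
  by (intro conjI ballI module_hom_add_fun[OF W] bilinear_hom_right[OF f] bilinear_hom_right[OF g]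
      bilinear_hom_left[OF f] bilinear_hom_left[OF g])

lemma bilinear_minus_fun:
  assumes W: "module K W" and f: "bilinear K U V W f" and g: "bilinear K U V W g"
  shows "bilinear K U V W (\<lambda>x y. f x y \<ominus>\<^bsub>W\<^esub> g x y)"
  unfolding bilinear_def
  by (intro conjI ballI module_hom_minus_fun[OF W] bilinear_hom_right[OF f] bilinear_hom_right[OF g]
      bilinear_hom_left[OF f] bilinear_hom_left[OF g])

lemma bilinear_flip: "bilinear K U V W f \<Longrightarrow> bilinear K V U W (\<lambda>x y. f y x)"
  by (auto simp: bilinear_def)

lemma bilinear_Pair:
  "bilinear K U V W f \<Longrightarrow> bilinear K U V W' g \<Longrightarrow>
    bilinear K U V (direct_sum W W') (\<lambda>x y. (f x y, g x y))"
  by (simp add: bilinear_def module_hom_Pair)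

lemma
  assumes "trilinear K A B C D f"
  shows trilinear_hom1: "y \<in> carrier B \<Longrightarrow> z \<in> carrier C \<Longrightarrow> (\<lambda>x. f x y z) \<in> module_hom K A D"
    and trilinear_hom2: "x \<in> carrier A \<Longrightarrow> z \<in> carrier C \<Longrightarrow> (\<lambda>y. f x y z) \<in> module_hom K B D"
    and trilinear_hom3: "x \<in> carrier A \<Longrightarrow> y \<in> carrier B \<Longrightarrow> (\<lambda>z. f x y z) \<in> module_hom K C D"
  using assms unfolding trilinear_def by blast+


section \<open>Tensor products and exterior squares\<close>

text \<open>\<open>Q\<close> is the module with generators \<open>B\<close> and relations \<open>S\<close>. The shape of \<open>F\<close>, \<open>N\<close> and \<open>Q\<close> is
  assumed by equations, which the definitions of \<^const>\<open>tensor_space\<close> and \<^const>\<open>ext_square\<close>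
  discharge as they stand.\<close>

context
  fixes R B S F N Q
  assumes R: "cring R" and F_def: "F = free_space R B" and S: "S \<subseteq> carrier F"
    and N_def: "N = LinearCombinations.module.span R F S" and Q_def: "Q = quotient_space F N"
begin

lemma presentation_free_module: "module R F"
  using cring.free_space_module[OF R] by (simp add: F_def)

lemma presentation_submodule: "submodule R N F"
  using module.span_is_submodule[OF presentation_free_module S] by (simp add: N_def)

lemma presentation_module: "module R Q"
  unfolding Q_def by (rule quotient_module[OF presentation_free_module presentation_submodule])

lemma presentation_map_hom: "(\<lambda>a. N +>\<^bsub>F\<^esub> a) \<in> module_hom R F Q"
  unfolding Q_def by (rule quotient_map_hom[OF presentation_free_module presentation_submodule])

lemma presentation_map_relation:
  assumes "r \<in> S" shows "N +>\<^bsub>F\<^esub> r = \<zero>\<^bsub>Q\<^esub>"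
proof -
  have "r \<in> N" using module.in_own_span[OF presentation_free_module S] assms by (auto simp: N_def)
  then show ?thesis
    using quotient_eq_zero_iff[OF presentation_free_module presentation_submodule] assms S
    by (auto simp: Q_def)
qed

text \<open>The coset map is linear and onto, so induction over the free module carries over to the
  quotient.\<close>

lemma presentation_induct:
  assumes a: "a \<in> carrier Q"
    and add: "\<And>a b. a \<in> carrier Q \<Longrightarrow> b \<in> carrier Q \<Longrightarrow> P a \<Longrightarrow> P b \<Longrightarrow> P (a \<oplus>\<^bsub>Q\<^esub> b)"
    and smult: "\<And>c a. c \<in> carrier R \<Longrightarrow> a \<in> carrier Q \<Longrightarrow> P a \<Longrightarrow> P (c \<odot>\<^bsub>Q\<^esub> a)"
    and zero: "P \<zero>\<^bsub>Q\<^esub>"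
    and gen: "\<And>x. x \<in> B \<Longrightarrow> P (N +>\<^bsub>F\<^esub> basis_vec R x)"
  shows "P a"
proof -
  note hom = presentation_map_hom
  obtain f where f: "f \<in> carrier F" "a = N +>\<^bsub>F\<^esub> f"
    using a by (auto simp: Q_def quotient_space_carrier)
  have "P (N +>\<^bsub>F\<^esub> f)" using f(1) unfolding F_def
  proof (induction rule: cring.free_space_induct[OF R, consumes 1, case_names zero add smult basis])
    case zero
    then show ?case
      using assms(4) module_hom_zero[OF presentation_free_module presentation_module hom]
      by (simp add: F_def)
  next
    case (add f g)
    then show ?case
      using assms(2) module_hom_carrier[OF hom] LinearCombinations.module_hom_add[OF hom]
      by (metis F_def)
  next
    case (smult c f)
    then show ?case
      using assms(3) module_hom_carrier[OF hom] LinearCombinations.module_hom_smult[OF hom]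
      by (metis F_def)
  qed (use gen in \<open>simp add: F_def\<close>)
  with f show ?thesis by simp
qed

text \<open>The extension of \<phi> to the free module is produced inside the proof, so
  \<open>rel\<close> has to speak of an arbitrary such extension. Its kernel is a submodule
  containing S, hence contains the span N, and the extension descends to Q.\<close>

lemma presentation_lift:
  assumes P: "module R P" and \<phi>: "\<phi> \<in> B \<rightarrow> carrier P"
    and rel: "\<And>h. h \<in> module_hom R F P \<Longrightarrow> \<forall>x\<in>B. h (basis_vec R x) = \<phi> x \<Longrightarrow> \<forall>r\<in>S. h r = \<zero>\<^bsub>P\<^esub>"
  shows "\<exists>g\<in>module_hom R Q P. \<forall>x\<in>B. g (N +>\<^bsub>F\<^esub> basis_vec R x) = \<phi> x"
proof -
  note F = presentation_free_module
  obtain h where h: "h \<in> module_hom R F P" "\<forall>x\<in>B. h (basis_vec R x) = \<phi> x"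
    using cring.free_space_lift[OF R P \<phi>] by (auto simp: F_def)
  interpret h: mod_hom R F P h using F P h(1) by (rule mod_hom_if_module_hom)
  have "N \<subseteq> h.ker"
    unfolding N_def using rel[OF h] S by (intro module.span_is_subset[OF F _ h.ker_is_submodule])
      (auto simp: h.ker_def)
  then obtain g where g: "g \<in> module_hom R Q P" "\<forall>a\<in>carrier F. g (N +>\<^bsub>F\<^esub> a) = h a"
    using quotient_lift[OF F presentation_submodule P h(1)] by (auto simp: h.ker_def Q_def)
  moreover have "basis_vec R x \<in> carrier F" if "x \<in> B" for x
    using cring.basis_vec_closed[OF R that] by (simp add: F_def)
  ultimately show ?thesis using h(2) by (intro bexI[of _ g]) auto
qed

end

section \<open>Tensor products: generators, relations and the universal property\<close>

context
  fixes K V W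
  assumes V_mod: "module K V" and W_mod: "module K W"
begin

interpretation V: Module.module K V by (rule V_mod)
interpretation W: Module.module K W by (rule W_mod)
interpretation F: Module.module K "free_space K (carrier V \<times> carrier W)"
  by (rule V.free_space_module)

lemma basis_pair_closed:
  "x \<in> carrier V \<Longrightarrow> y \<in> carrier W \<Longrightarrow>
    basis_vec K (x, y) \<in> carrier (free_space K (carrier V \<times> carrier W))"
  by (rule V.basis_vec_closed) simp

lemma bilinear_relations_closed:
  "bilinear_relations K V W \<subseteq> carrier (free_space K (carrier V \<times> carrier W))"
  unfolding bilinear_relations_def Let_def
  by (intro Un_least subsetI; elim CollectE exE conjE; hypsubst)
    (intro F.minus_closed F.a_closed F.smult_closed basis_pair_closed V.a_closed W.a_closed
      V.smult_closed W.smult_closed; assumption)+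

text \<open>The four families of relations are exactly the four clauses of bilinearity, written as
  differences. Read from left to right for the coset map, this makes \<open>tensor\<close> and
  \<open>wedge\<close> bilinear; read from right to left, it shows that the extension of a bilinear
  map to the free module kills the relations, as the lifts require.\<close>

lemma bilinear_relations_kernel_iff:
  assumes P: "module K P" and h: "h \<in> module_hom K (free_space K (carrier V \<times> carrier W)) P"
  shows "(\<forall>r\<in>bilinear_relations K V W. h r = \<zero>\<^bsub>P\<^esub>) \<longleftrightarrow>
    bilinear K V W P (\<lambda>x y. h (basis_vec K (x, y)))"
proof -
  interpret P: Module.module K P by fact
  let ?F = "free_space K (carrier V \<times> carrier W)"
  let ?d = "\<lambda>x y. basis_vec K (x, y)"
  have *: "h (a \<ominus>\<^bsub>?F\<^esub> b) = \<zero>\<^bsub>P\<^esub> \<longleftrightarrow> h a = h b" if "a \<in> carrier ?F" "b \<in> carrier ?F" for a b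
    unfolding module_hom_minus[OF V.free_space_module P h that]
    using module_hom_carrier[OF h that(1)] module_hom_carrier[OF h that(2)]
    by (simp only: P.minus_other_side P.zero_closed P.l_zero)
  note simps = * basis_pair_closed LinearCombinations.module_hom_add[OF h] LinearCombinations.module_hom_smult[OF h]
  have "(\<forall>r\<in>bilinear_relations K V W. h r = \<zero>\<^bsub>P\<^esub>) \<longleftrightarrow>
     (\<forall>x\<in>carrier V. \<forall>x'\<in>carrier V. \<forall>y\<in>carrier W.
       h (?d (x \<oplus>\<^bsub>V\<^esub> x') y \<ominus>\<^bsub>?F\<^esub> (?d x y \<oplus>\<^bsub>?F\<^esub> ?d x' y)) = \<zero>\<^bsub>P\<^esub>) \<and>
     (\<forall>x\<in>carrier V. \<forall>y\<in>carrier W. \<forall>y'\<in>carrier W.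
       h (?d x (y \<oplus>\<^bsub>W\<^esub> y') \<ominus>\<^bsub>?F\<^esub> (?d x y \<oplus>\<^bsub>?F\<^esub> ?d x y')) = \<zero>\<^bsub>P\<^esub>) \<and>
     (\<forall>c\<in>carrier K. \<forall>x\<in>carrier V. \<forall>y\<in>carrier W.
       h (?d (c \<odot>\<^bsub>V\<^esub> x) y \<ominus>\<^bsub>?F\<^esub> c \<odot>\<^bsub>?F\<^esub> ?d x y) = \<zero>\<^bsub>P\<^esub>) \<and>
     (\<forall>c\<in>carrier K. \<forall>x\<in>carrier V. \<forall>y\<in>carrier W.
       h (?d x (c \<odot>\<^bsub>W\<^esub> y) \<ominus>\<^bsub>?F\<^esub> c \<odot>\<^bsub>?F\<^esub> ?d x y) = \<zero>\<^bsub>P\<^esub>)"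
    unfolding bilinear_relations_def Let_def by blast
  also have "\<dots> \<longleftrightarrow>
     (\<forall>x\<in>carrier V. \<forall>x'\<in>carrier V. \<forall>y\<in>carrier W.
       h (?d (x \<oplus>\<^bsub>V\<^esub> x') y) = h (?d x y) \<oplus>\<^bsub>P\<^esub> h (?d x' y)) \<and>
     (\<forall>x\<in>carrier V. \<forall>y\<in>carrier W. \<forall>y'\<in>carrier W.
       h (?d x (y \<oplus>\<^bsub>W\<^esub> y')) = h (?d x y) \<oplus>\<^bsub>P\<^esub> h (?d x y')) \<and>
     (\<forall>c\<in>carrier K. \<forall>x\<in>carrier V. \<forall>y\<in>carrier W.
       h (?d (c \<odot>\<^bsub>V\<^esub> x) y) = c \<odot>\<^bsub>P\<^esub> h (?d x y)) \<and>
     (\<forall>c\<in>carrier K. \<forall>x\<in>carrier V. \<forall>y\<in>carrier W.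
       h (?d x (c \<odot>\<^bsub>W\<^esub> y)) = c \<odot>\<^bsub>P\<^esub> h (?d x y))"
    by (simp add: simps cong: ball_cong)
  also have "\<dots> \<longleftrightarrow> bilinear K V W P (\<lambda>x y. h (?d x y))" (is "?eqs \<longleftrightarrow> ?bil")
  proof
    show ?bil if ?eqs
      using that module_hom_carrier[OF h basis_pair_closed] by (intro bilinearI) auto
    show ?eqs if bil: ?bil
      by (simp add: bilinear_add_left[OF bil] bilinear_add_right[OF bil]
          bilinear_smult_left[OF bil] bilinear_smult_right[OF bil])
  qed
  finally show ?thesis .
qed

lemmas tensor_presentation =
  V.is_cring refl bilinear_relations_closed tensor_rel_def tensor_space_def

lemma tensor_space_module: "module K (tensor_space K V W)"
  using tensor_presentation by (rule presentation_module)

lemma tensor_bilinear: "bilinear K V W (tensor_space K V W) (tensor K V W)"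
  unfolding tensor_def[abs_def]
  using bilinear_relations_kernel_iff[OF tensor_space_module presentation_map_hom[OF tensor_presentation]]
    presentation_map_relation[OF tensor_presentation]
  by simp

lemma tensor_space_hom_eqI:
  assumes P: "module K P" and f: "f \<in> module_hom K (tensor_space K V W) P"
    and g: "g \<in> module_hom K (tensor_space K V W) P"
    and eq: "\<And>x y. x \<in> carrier V \<Longrightarrow> y \<in> carrier W \<Longrightarrow> f (tensor K V W x y) = g (tensor K V W x y)"
    and a: "a \<in> carrier (tensor_space K V W)"
  shows "f a = g a"
  using a
proof (induction a rule: presentation_induct[OF tensor_presentation, consumes 1, case_names add smult zero gen])
  case (add a b)
  then show ?case using LinearCombinations.module_hom_add[OF f] LinearCombinations.module_hom_add[OF g] by simp
next
  case (smult c a)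
  then show ?case
    using LinearCombinations.module_hom_smult[OF f] LinearCombinations.module_hom_smult[OF g] by simp
next
  case zero
  then show ?case
    using module_hom_zero[OF tensor_space_module P f] module_hom_zero[OF tensor_space_module P g] by simp
qed (use eq in \<open>auto simp: tensor_def\<close>)

lemma tensor_lift:
  assumes P: "module K P" and f: "bilinear K V W P f"
  shows "\<exists>h\<in>module_hom K (tensor_space K V W) P.
    \<forall>x\<in>carrier V. \<forall>y\<in>carrier W. h (tensor K V W x y) = f x y"
proof -
  have *: "\<forall>r\<in>bilinear_relations K V W. h r = \<zero>\<^bsub>P\<^esub>"
    if "h \<in> module_hom K (free_space K (carrier V \<times> carrier W)) P"
      "\<forall>z\<in>carrier V \<times> carrier W. h (basis_vec K z) = (case z of (x, y) \<Rightarrow> f x y)" for h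
    unfolding bilinear_relations_kernel_iff[OF P that(1)]
    using that(2) by (intro bilinear_cong[OF V_mod W_mod f]) simp
  have "(\<lambda>(x, y). f x y) \<in> carrier V \<times> carrier W \<rightarrow> carrier P"
    using bilinear_closed[OF f] by auto
  then have "\<exists>h\<in>module_hom K (tensor_space K V W) P. \<forall>z\<in>carrier V \<times> carrier W.
      h (case z of (x, y) \<Rightarrow> tensor K V W x y) = (case z of (x, y) \<Rightarrow> f x y)"
    unfolding tensor_def case_prod_eta prod.collapse split_beta
    by (rule presentation_lift[OF tensor_presentation P]) (use * in \<open>simp add: split_beta\<close>)
  then show ?thesis by auto
qed

end

section \<open>Exterior squares: generators, relations and lifts of alternating maps\<close>

context
  fixes K V
  assumes V_mod: "module K V"
begin

interpretation V: Module.module K V by (rule V_mod)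

lemma ext_relations_closed:
  "bilinear_relations K V V \<union> {basis_vec K (x, x) | x. x \<in> carrier V}
    \<subseteq> carrier (free_space K (carrier V \<times> carrier V))"
  using bilinear_relations_closed[OF V_mod V_mod] basis_pair_closed[OF V_mod V_mod] by blast

lemmas ext_square_presentation =
  V.is_cring refl ext_relations_closed ext_rel_def ext_square_def

lemma ext_square_module: "module K (ext_square K V)"
  using ext_square_presentation by (rule presentation_module)

lemma wedge_bilinear: "bilinear K V V (ext_square K V) (wedge K V)"
  unfolding wedge_def[abs_def]
  using bilinear_relations_kernel_iff[OF V_mod V_mod ext_square_module
      presentation_map_hom[OF ext_square_presentation]]
    presentation_map_relation[OF ext_square_presentation]
  by simp

lemma wedge_same: "x \<in> carrier V \<Longrightarrow> wedge K V x x = \<zero>\<^bsub>ext_square K V\<^esub>"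
  unfolding wedge_def by (rule presentation_map_relation[OF ext_square_presentation]) blast

lemma ext_square_hom_eqI:
  assumes P: "module K P" and f: "f \<in> module_hom K (ext_square K V) P"
    and g: "g \<in> module_hom K (ext_square K V) P"
    and eq: "\<And>x y. x \<in> carrier V \<Longrightarrow> y \<in> carrier V \<Longrightarrow> f (wedge K V x y) = g (wedge K V x y)"
    and a: "a \<in> carrier (ext_square K V)"
  shows "f a = g a"
  using a
proof (induction a rule: presentation_induct[OF ext_square_presentation, consumes 1, case_names add smult zero gen])
  case (add a b)
  then show ?case using LinearCombinations.module_hom_add[OF f] LinearCombinations.module_hom_add[OF g] by simp
next
  case (smult c a)
  then show ?case
    using LinearCombinations.module_hom_smult[OF f] LinearCombinations.module_hom_smult[OF g] by simp
next
  case zero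
  then show ?case
    using module_hom_zero[OF ext_square_module P f] module_hom_zero[OF ext_square_module P g] by simp
qed (use eq in \<open>auto simp: wedge_def\<close>)

lemma ext_square_lift:
  assumes P: "module K P" and f: "bilinear K V V P f"
    and alt: "\<And>x. x \<in> carrier V \<Longrightarrow> f x x = \<zero>\<^bsub>P\<^esub>"
  shows "\<exists>h\<in>module_hom K (ext_square K V) P.
    \<forall>x\<in>carrier V. \<forall>y\<in>carrier V. h (wedge K V x y) = f x y"
proof -
  have *: "\<forall>r\<in>bilinear_relations K V V \<union> {basis_vec K (x, x) | x. x \<in> carrier V}. h r = \<zero>\<^bsub>P\<^esub>"
    if "h \<in> module_hom K (free_space K (carrier V \<times> carrier V)) P"
      "\<forall>z\<in>carrier V \<times> carrier V. h (basis_vec K z) = (case z of (x, y) \<Rightarrow> f x y)" for h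
  proof -
    have "\<forall>r\<in>bilinear_relations K V V. h r = \<zero>\<^bsub>P\<^esub>"
      unfolding bilinear_relations_kernel_iff[OF V_mod V_mod P that(1)]
      using that(2) by (intro bilinear_cong[OF V_mod V_mod f]) simp
    then show ?thesis using that(2) alt by auto
  qed
  have "(\<lambda>(x, y). f x y) \<in> carrier V \<times> carrier V \<rightarrow> carrier P"
    using bilinear_closed[OF f] by auto
  then have "\<exists>h\<in>module_hom K (ext_square K V) P. \<forall>z\<in>carrier V \<times> carrier V.
      h (case z of (x, y) \<Rightarrow> wedge K V x y) = (case z of (x, y) \<Rightarrow> f x y)"
    unfolding wedge_def case_prod_eta prod.collapse split_beta
    by (rule presentation_lift[OF ext_square_presentation P]) (use * in \<open>simp add: split_beta\<close>)
  then show ?thesis by auto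
qed

lemma wedge_skew:
  "x \<in> carrier V \<Longrightarrow> y \<in> carrier V \<Longrightarrow> wedge K V y x = \<ominus>\<^bsub>ext_square K V\<^esub> wedge K V x y"
  using alternating_skew[OF V_mod ext_square_module wedge_bilinear wedge_same] .

text \<open>For each fixed u the universal property gives a linear map \<open>h u\<close> on the
  exterior square. These maps are chosen independently of each other; their linear dependence on u
  comes from uniqueness, because the linear maps being compared agree on wedges.\<close>

lemma ext_square_bilinear_lift:
  assumes U: "module K U" and P: "module K P"
    and hom: "\<And>x y. x \<in> carrier V \<Longrightarrow> y \<in> carrier V \<Longrightarrow> f x y \<in> module_hom K U P"
    and bil: "\<And>u. u \<in> carrier U \<Longrightarrow> bilinear K V V P (\<lambda>x y. f x y u)"
    and alt: "\<And>x u. x \<in> carrier V \<Longrightarrow> u \<in> carrier U \<Longrightarrow> f x x u = \<zero>\<^bsub>P\<^esub>"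
  shows "\<exists>B. bilinear K (ext_square K V) U P B \<and>
    (\<forall>x\<in>carrier V. \<forall>y\<in>carrier V. \<forall>u\<in>carrier U. B (wedge K V x y) u = f x y u)"
proof -
  interpret U: Module.module K U by fact
  have "\<forall>u\<in>carrier U. \<exists>h. h \<in> module_hom K (ext_square K V) P \<and>
    (\<forall>x\<in>carrier V. \<forall>y\<in>carrier V. h (wedge K V x y) = f x y u)"
  proof
    fix u assume u: "u \<in> carrier U"
    show "\<exists>h. h \<in> module_hom K (ext_square K V) P \<and>
      (\<forall>x\<in>carrier V. \<forall>y\<in>carrier V. h (wedge K V x y) = f x y u)"
      using ext_square_lift[OF P bil[OF u] alt[OF _ u]] by (simp only: Bex_def)
  qed
  from bchoice[OF this] obtain h where
    h: "\<And>u. u \<in> carrier U \<Longrightarrow> h u \<in> module_hom K (ext_square K V) P" and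
    h_wedge: "\<And>u x y. u \<in> carrier U \<Longrightarrow> x \<in> carrier V \<Longrightarrow> y \<in> carrier V \<Longrightarrow>
      h u (wedge K V x y) = f x y u"
    by auto
  have "bilinear K (ext_square K V) U P (\<lambda>a u. h u a)"
    unfolding bilinear_def
  proof (intro conjI ballI)
    fix a assume a: "a \<in> carrier (ext_square K V)"
    show "(\<lambda>u. h u a) \<in> module_hom K U P"
    proof (rule module_homI)
      show "h u a \<in> carrier P" if "u \<in> carrier U" for u
        using module_hom_carrier[OF h[OF that] a] .
      show "h (u \<oplus>\<^bsub>U\<^esub> v) a = h u a \<oplus>\<^bsub>P\<^esub> h v a" if "u \<in> carrier U" "v \<in> carrier U" for u v
        by (rule ext_square_hom_eqI[OF P h module_hom_add_fun[OF P h h] _ a])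
          (simp_all add: that h_wedge U.a_closed LinearCombinations.module_hom_add[OF hom])
      show "h (c \<odot>\<^bsub>U\<^esub> u) a = c \<odot>\<^bsub>P\<^esub> h u a" if "c \<in> carrier K" "u \<in> carrier U" for c u
        by (rule ext_square_hom_eqI[OF P h module_hom_smult_fun[OF P _ h] _ a])
          (simp_all add: that h_wedge U.smult_closed LinearCombinations.module_hom_smult[OF hom])
    qed
  qed (rule h)
  then show ?thesis using h_wedge by blast
qed

end

section \<open>Linear maps induced on exterior squares\<close>

lemma ext_square_map:
  assumes V: "module K V" and W: "module K W" and d: "d \<in> module_hom K V W"
  shows "\<exists>h\<in>module_hom K (ext_square K V) (ext_square K W).
    \<forall>x\<in>carrier V. \<forall>y\<in>carrier V. h (wedge K V x y) = wedge K W (d x) (d y)"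
proof (rule ext_square_lift[OF V ext_square_module[OF W]])
  show "bilinear K V V (ext_square K W) (\<lambda>x y. wedge K W (d x) (d y))"
    by (rule bilinear_comp[OF wedge_bilinear[OF W] d d module_hom_id])
qed (rule wedge_same[OF W module_hom_carrier[OF d]])

text \<open>The assignment is alternating because d x \<and> x and x \<and> d x cancel by skew
  symmetry. With d = \<open>br x1 x2\<close> this is the left multiplication by x1 \<and> x2 in the
  fundamental bracket.\<close>

lemma ext_square_derivation:
  assumes V: "module K V" and d: "d \<in> module_hom K V V"
  shows "\<exists>h\<in>module_hom K (ext_square K V) (ext_square K V).
    \<forall>x\<in>carrier V. \<forall>y\<in>carrier V. h (wedge K V x y) =
      wedge K V (d x) y \<oplus>\<^bsub>ext_square K V\<^esub> wedge K V x (d y)"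
proof (rule ext_square_lift[OF V ext_square_module[OF V]])
  interpret E: Module.module K "ext_square K V" by (rule ext_square_module[OF V])
  note bil = wedge_bilinear[OF V]
  show "bilinear K V V (ext_square K V)
      (\<lambda>x y. wedge K V (d x) y \<oplus>\<^bsub>ext_square K V\<^esub> wedge K V x (d y))"
    by (rule bilinear_add_fun[OF ext_square_module[OF V]
          bilinear_comp[OF bil d module_hom_id module_hom_id]
          bilinear_comp[OF bil module_hom_id d module_hom_id]])
  show "wedge K V (d x) x \<oplus>\<^bsub>ext_square K V\<^esub> wedge K V x (d x) = \<zero>\<^bsub>ext_square K V\<^esub>"
    if "x \<in> carrier V" for x
    using wedge_skew[OF V that module_hom_carrier[OF d that]]
      bilinear_closed[OF bil that module_hom_carrier[OF d that]]
    by (simp add: E.l_neg)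
qed


section \<open>The Leibniz algebra of fundamental objects\<close>

context
  fixes K V br
  assumes lie: "three_lie_algebra K V br"
begin

lemma three_lie_module: "module K V"
  using lie unfolding three_lie_algebra_def vectorspace_def by blast

interpretation V: Module.module K V by (rule three_lie_module)
interpretation E: Module.module K "ext_square K V" by (rule ext_square_module[OF three_lie_module])

lemma three_lie_trilinear: "trilinear K V V V V br"
  using lie unfolding three_lie_algebra_def alternating_trilinear_def by blast

lemma three_lie_same: "x \<in> carrier V \<Longrightarrow> y \<in> carrier V \<Longrightarrow> br x x y = \<zero>\<^bsub>V\<^esub>"
  using lie unfolding three_lie_algebra_def alternating_trilinear_def by blast

lemma three_lie_closed:
  "x \<in> carrier V \<Longrightarrow> y \<in> carrier V \<Longrightarrow> z \<in> carrier V \<Longrightarrow> br x y z \<in> carrier V"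
  using module_hom_carrier[OF trilinear_hom3[OF three_lie_trilinear]] .

lemma three_lie_identity:
  "x1 \<in> carrier V \<Longrightarrow> x2 \<in> carrier V \<Longrightarrow> x3 \<in> carrier V \<Longrightarrow> x4 \<in> carrier V \<Longrightarrow> x5 \<in> carrier V \<Longrightarrow>
    br x1 x2 (br x3 x4 x5) =
      br (br x1 x2 x3) x4 x5 \<oplus>\<^bsub>V\<^esub> br x3 (br x1 x2 x4) x5 \<oplus>\<^bsub>V\<^esub> br x3 x4 (br x1 x2 x5)"
  using lie unfolding three_lie_algebra_def by blast

text \<open>Two lifts in succession. For fixed x and y, the map \<open>br x y\<close> induces the
  operator \<open>L x y\<close> on the exterior square; this operator is bilinear and alternating in
  (x, y) because \<open>br\<close> is, so it lifts in its first argument as well.\<close>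

lemma fundamental_bracket_exists:
  "\<exists>F. bilinear K (ext_square K V) (ext_square K V) (ext_square K V) F \<and>
    (\<forall>x1\<in>carrier V. \<forall>x2\<in>carrier V. \<forall>y1\<in>carrier V. \<forall>y2\<in>carrier V.
      F (wedge K V x1 x2) (wedge K V y1 y2) =
        wedge K V (br x1 x2 y1) y2 \<oplus>\<^bsub>ext_square K V\<^esub> wedge K V y1 (br x1 x2 y2))"
proof -
  let ?E = "ext_square K V"
  note V = three_lie_module
  note E = ext_square_module[OF V]
  note bil = wedge_bilinear[OF V]
  note wedge_simps = bilinear_closed[OF bil] bilinear_add_left[OF bil] bilinear_add_right[OF bil]
    bilinear_smult_left[OF bil] bilinear_smult_right[OF bil]
    bilinear_zero_left[OF V V E bil] bilinear_zero_right[OF V V E bil]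
  note tri = three_lie_trilinear
  note br_simps = three_lie_closed three_lie_same
    LinearCombinations.module_hom_add[OF trilinear_hom1[OF tri]]
    LinearCombinations.module_hom_add[OF trilinear_hom2[OF tri]]
    LinearCombinations.module_hom_smult[OF trilinear_hom1[OF tri]]
    LinearCombinations.module_hom_smult[OF trilinear_hom2[OF tri]]
  define L where "L x y = (SOME h. h \<in> module_hom K ?E ?E \<and>
    (\<forall>y1\<in>carrier V. \<forall>y2\<in>carrier V. h (wedge K V y1 y2) =
      wedge K V (br x y y1) y2 \<oplus>\<^bsub>?E\<^esub> wedge K V y1 (br x y y2)))" for x y
  have L: "L x y \<in> module_hom K ?E ?E \<and>
    (\<forall>y1\<in>carrier V. \<forall>y2\<in>carrier V. L x y (wedge K V y1 y2) =
      wedge K V (br x y y1) y2 \<oplus>\<^bsub>?E\<^esub> wedge K V y1 (br x y y2))"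
    if "x \<in> carrier V" "y \<in> carrier V" for x y
    using someI_ex[OF ext_square_derivation[OF V trilinear_hom3[OF tri that], unfolded Bex_def]]
    unfolding L_def .
  then have hom: "\<And>x y. x \<in> carrier V \<Longrightarrow> y \<in> carrier V \<Longrightarrow> L x y \<in> module_hom K ?E ?E"
    and L_wedge: "\<And>x y y1 y2. x \<in> carrier V \<Longrightarrow> y \<in> carrier V \<Longrightarrow> y1 \<in> carrier V \<Longrightarrow>
      y2 \<in> carrier V \<Longrightarrow> L x y (wedge K V y1 y2) =
        wedge K V (br x y y1) y2 \<oplus>\<^bsub>?E\<^esub> wedge K V y1 (br x y y2)"
    by blast+
  have L_bilinear: "bilinear K V V ?E (\<lambda>x y. L x y u)" if u: "u \<in> carrier ?E" for u
  proof (rule bilinearI)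
    show "L x y u \<in> carrier ?E" if "x \<in> carrier V" "y \<in> carrier V" for x y
      using module_hom_carrier[OF hom[OF that] u] .
    show "L (x \<oplus>\<^bsub>V\<^esub> x') y u = L x y u \<oplus>\<^bsub>?E\<^esub> L x' y u"
      if "x \<in> carrier V" "x' \<in> carrier V" "y \<in> carrier V" for x x' y
      by (rule ext_square_hom_eqI[OF V E hom module_hom_add_fun[OF E hom hom] _ u])
        (simp_all add: that L_wedge V.a_closed br_simps wedge_simps E.a_ac)
    show "L x (y \<oplus>\<^bsub>V\<^esub> y') u = L x y u \<oplus>\<^bsub>?E\<^esub> L x y' u"
      if "x \<in> carrier V" "y \<in> carrier V" "y' \<in> carrier V" for x y y'
      by (rule ext_square_hom_eqI[OF V E hom module_hom_add_fun[OF E hom hom] _ u])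
        (simp_all add: that L_wedge V.a_closed br_simps wedge_simps E.a_ac)
    show "L (c \<odot>\<^bsub>V\<^esub> x) y u = c \<odot>\<^bsub>?E\<^esub> L x y u"
      if "c \<in> carrier K" "x \<in> carrier V" "y \<in> carrier V" for c x y
      by (rule ext_square_hom_eqI[OF V E hom module_hom_smult_fun[OF E _ hom] _ u])
        (simp_all add: that L_wedge V.smult_closed br_simps wedge_simps E.smult_r_distr)
    show "L x (c \<odot>\<^bsub>V\<^esub> y) u = c \<odot>\<^bsub>?E\<^esub> L x y u"
      if "c \<in> carrier K" "x \<in> carrier V" "y \<in> carrier V" for c x y
      by (rule ext_square_hom_eqI[OF V E hom module_hom_smult_fun[OF E _ hom] _ u])
        (simp_all add: that L_wedge V.smult_closed br_simps wedge_simps E.smult_r_distr)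
  qed
  \<comment> \<open>On wedges both terms contain \<open>br x x\<close>, which vanishes.\<close>
  have L_same: "L x x u = \<zero>\<^bsub>?E\<^esub>" if "x \<in> carrier V" "u \<in> carrier ?E" for x u
    by (rule ext_square_hom_eqI[OF V E hom module_hom_zero_fun[OF E] _ that(2)])
      (simp_all add: that L_wedge br_simps wedge_simps)
  have "\<exists>F. bilinear K ?E ?E ?E F \<and>
    (\<forall>x\<in>carrier V. \<forall>y\<in>carrier V. \<forall>u\<in>carrier ?E. F (wedge K V x y) u = L x y u)"
    by (rule ext_square_bilinear_lift[OF V E E hom L_bilinear L_same])
  then obtain F where F: "bilinear K ?E ?E ?E F"
    "\<forall>x\<in>carrier V. \<forall>y\<in>carrier V. \<forall>u\<in>carrier ?E. F (wedge K V x y) u = L x y u"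
    by blast
  show ?thesis
    using F by (intro exI[of _ F]) (simp add: L_wedge wedge_simps)
qed

lemma fundamental_bracket_bilinear:
    "bilinear K (ext_square K V) (ext_square K V) (ext_square K V) (fundamental_bracket K V br)"
  and fundamental_bracket_wedge:
    "x1 \<in> carrier V \<Longrightarrow> x2 \<in> carrier V \<Longrightarrow> y1 \<in> carrier V \<Longrightarrow> y2 \<in> carrier V \<Longrightarrow>
      fundamental_bracket K V br (wedge K V x1 x2) (wedge K V y1 y2) =
        wedge K V (br x1 x2 y1) y2 \<oplus>\<^bsub>ext_square K V\<^esub> wedge K V y1 (br x1 x2 y2)"
  using someI_ex[OF fundamental_bracket_exists, folded fundamental_bracket_def] by simp_all

text \<open>Write X and Y for the maps \<open>br x1 x2\<close> and \<open>br y1 y2\<close>. On z1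
  \<and> z2 the mixed terms X z1 \<and> Y z2 and Y z1 \<and> X z2 occur on both sides. What remains
  is the commutator of X and Y acting on z1 or on z2, and the 3-Lie identity equates it with the
  action of [x1 \<and> x2, y1 \<and> y2].\<close>

lemma fundamental_bracket_leibniz_algebra:
  "leibniz_algebra K (ext_square K V) (fundamental_bracket K V br)"
proof -
  let ?E = "ext_square K V"
  let ?F = "fundamental_bracket K V br"
  note V = three_lie_module
  note E = ext_square_module[OF V]
  note bil = wedge_bilinear[OF V]
  note F = fundamental_bracket_bilinear
  note closed = bilinear_closed[OF bil] bilinear_closed[OF F] three_lie_closed
  note F_right = bilinear_hom_right[OF F] and F_left = bilinear_hom_left[OF F]
  let ?leibniz = "\<lambda>a b c. ?F a (?F b c) = ?F (?F a b) c \<oplus>\<^bsub>?E\<^esub> ?F b (?F a c)"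
  have wedges: "?leibniz (wedge K V x1 x2) (wedge K V y1 y2) (wedge K V z1 z2)"
    if "x1 \<in> carrier V" "x2 \<in> carrier V" "y1 \<in> carrier V" "y2 \<in> carrier V"
      "z1 \<in> carrier V" "z2 \<in> carrier V" for x1 x2 y1 y2 z1 z2
    using that
    by (simp add: fundamental_bracket_wedge closed bilinear_add_left[OF F] bilinear_add_right[OF F]
        bilinear_add_left[OF bil] bilinear_add_right[OF bil] three_lie_identity[of x1 x2 y1 y2]
        V.a_closed E.a_ac)
  \<comment> \<open>Both sides are linear in each argument, so decomposables are replaced by
    arbitrary elements in the third, then the second, then the first place.\<close>
  have wedges2: "?leibniz (wedge K V x1 x2) (wedge K V y1 y2) c"
    if "x1 \<in> carrier V" "x2 \<in> carrier V" "y1 \<in> carrier V" "y2 \<in> carrier V" "c \<in> carrier ?E"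
    for x1 x2 y1 y2 c
    by (rule ext_square_hom_eqI[OF V E module_hom_comp[OF F_right F_right]
          module_hom_add_fun[OF E F_right module_hom_comp[OF F_right F_right]] wedges])
      (simp_all add: that closed)
  have wedges1: "?leibniz (wedge K V x1 x2) b c"
    if "x1 \<in> carrier V" "x2 \<in> carrier V" "b \<in> carrier ?E" "c \<in> carrier ?E" for x1 x2 b c
    by (rule ext_square_hom_eqI[OF V E module_hom_comp[OF F_left F_right]
          module_hom_add_fun[OF E module_hom_comp[OF F_right F_left] F_left] wedges2])
      (simp_all add: that closed)
  have "?leibniz a b c" if "a \<in> carrier ?E" "b \<in> carrier ?E" "c \<in> carrier ?E" for a b c
    by (rule ext_square_hom_eqI[OF V E F_left
          module_hom_add_fun[OF E module_hom_comp[OF F_left F_left] module_hom_comp[OF F_left F_right]]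
          wedges1])
      (simp_all add: that closed)
  moreover have "vectorspace K ?E"
    using E lie unfolding three_lie_algebra_def vectorspace_def by blast
  ultimately show ?thesis using F unfolding leibniz_algebra_def by blast
qed

end


text \<open>On wedges the claim is the compatibility of d with the 3-Lie brackets, applied to each
  of the two terms; bilinearity does the rest. With d = \<open>fst\<close> it makes
  \<open>ext_square_projection\<close> a morphism of Leibniz algebras.\<close>

lemma leibniz_hom_fundamental:
  assumes V: "three_lie_algebra K V brV" and W: "three_lie_algebra K W brW"
    and d: "three_lie_hom K V brV W brW d"
    and h: "h \<in> module_hom K (ext_square K V) (ext_square K W)"
    and h_wedge: "\<And>x y. x \<in> carrier V \<Longrightarrow> y \<in> carrier V \<Longrightarrow>
      h (wedge K V x y) = wedge K W (d x) (d y)"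
  shows "leibniz_hom K (ext_square K V) (fundamental_bracket K V brV)
    (ext_square K W) (fundamental_bracket K W brW) h"
proof -
  let ?F = "fundamental_bracket K V brV" and ?F' = "fundamental_bracket K W brW"
  note V_mod = three_lie_module[OF V] and W_mod = three_lie_module[OF W]
  note EV = ext_square_module[OF V_mod] and EW = ext_square_module[OF W_mod]
  note F = fundamental_bracket_bilinear[OF V] and F' = fundamental_bracket_bilinear[OF W]
  have d_hom: "d \<in> module_hom K V W"
    using d by (simp add: three_lie_hom_def linear_map_def mod_hom_def mod_hom_axioms_def)
  have d_br: "d (brV x y z) = brW (d x) (d y) (d z)"
    if "x \<in> carrier V" "y \<in> carrier V" "z \<in> carrier V" for x y z
    using d that by (simp add: three_lie_hom_def)
  note closed = bilinear_closed[OF wedge_bilinear[OF V_mod]] three_lie_closed[OF V]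
    module_hom_carrier[OF d_hom] module_hom_carrier[OF h] bilinear_closed[OF F]
  have wedges: "h (?F (wedge K V x1 x2) (wedge K V y1 y2)) =
      ?F' (h (wedge K V x1 x2)) (h (wedge K V y1 y2))"
    if "x1 \<in> carrier V" "x2 \<in> carrier V" "y1 \<in> carrier V" "y2 \<in> carrier V" for x1 x2 y1 y2
    using that
    by (simp add: h_wedge fundamental_bracket_wedge[OF V] fundamental_bracket_wedge[OF W] closed
        LinearCombinations.module_hom_add[OF h] d_br)
  have wedges1: "h (?F (wedge K V x1 x2) b) = ?F' (h (wedge K V x1 x2)) (h b)"
    if "x1 \<in> carrier V" "x2 \<in> carrier V" "b \<in> carrier (ext_square K V)" for x1 x2 b
    by (rule ext_square_hom_eqI[OF V_mod EW module_hom_comp[OF bilinear_hom_right[OF F] h]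
          module_hom_comp[OF h bilinear_hom_right[OF F']] wedges])
      (simp_all add: that closed)
  have "h (?F a b) = ?F' (h a) (h b)"
    if "a \<in> carrier (ext_square K V)" "b \<in> carrier (ext_square K V)" for a b
    by (rule ext_square_hom_eqI[OF V_mod EW module_hom_comp[OF bilinear_hom_left[OF F] h]
          module_hom_comp[OF h bilinear_hom_left[OF F']] wedges1])
      (simp_all add: that closed)
  moreover have "linear_map K (ext_square K V) (ext_square K W) h"
    using mod_hom_if_module_hom[OF EV EW h] d
    by (simp add: three_lie_hom_def linear_map_def vectorspace_def EV EW)
  ultimately show ?thesis by (simp add: leibniz_hom_def)
qed

section \<open>Split exact sequences of Leibniz algebras\<close>

text \<open>The maps r and s split the sequence linearly, while brackets are controlled by p alone.
  This separates the abstract argument from the computation with wedges, which enters only through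
  \<open>B_eq\<close>.\<close>

lemma leibniz_extension_split:
  assumes S: "vectorspace K S" and E: "leibniz_algebra K E F" and Q: "leibniz_algebra K Q F'"
    and p: "leibniz_hom K E F Q F' p"
    and i: "i \<in> module_hom K S E" and r: "r \<in> module_hom K E S" and s: "s \<in> module_hom K Q E"
    and ri: "\<And>a. a \<in> carrier S \<Longrightarrow> r (i a) = a"
    and pi: "\<And>a. a \<in> carrier S \<Longrightarrow> p (i a) = \<zero>\<^bsub>Q\<^esub>"
    and ps: "\<And>c. c \<in> carrier Q \<Longrightarrow> p (s c) = c"
    and split: "\<And>b. b \<in> carrier E \<Longrightarrow> i (r b) \<oplus>\<^bsub>E\<^esub> s (p b) = b"
    and B: "bilinear K S S S B"
    and B_eq: "\<And>a b. a \<in> carrier S \<Longrightarrow> b \<in> carrier S \<Longrightarrow> B a b = r (F (i a) (i b))"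
  shows "leibniz_extension K S B E F Q F' i p"
proof -
  have E_vs: "vectorspace K E" and Q_vs: "vectorspace K Q"
    and F: "bilinear K E E E F" and F': "bilinear K Q Q Q F'"
    using E Q unfolding leibniz_algebra_def by blast+
  have S_mod: "module K S" and E_mod: "module K E" and Q_mod: "module K Q"
    using S E_vs Q_vs by (auto simp: vectorspace_def)
  interpret S: Module.module K S by (rule S_mod)
  interpret E: Module.module K E by (rule E_mod)
  interpret Q: Module.module K Q by (rule Q_mod)
  have p_hom: "p \<in> module_hom K E Q"
    using p by (simp add: leibniz_hom_def linear_map_def mod_hom_def mod_hom_axioms_def)
  have p_F: "p (F a b) = F' (p a) (p b)" if "a \<in> carrier E" "b \<in> carrier E" for a b
    using p that by (simp add: leibniz_hom_def)
  note i_closed = module_hom_carrier[OF i] and r_closed = module_hom_carrier[OF r]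
    and p_closed = module_hom_carrier[OF p_hom] and F_closed = bilinear_closed[OF F]
    and B_closed = bilinear_closed[OF B]
  \<comment> \<open>On the kernel of p the summand s (p b) of the splitting is s 0 = 0. This gives
    exactness in the middle as well as \<open>i_B\<close>.\<close>
  have ir: "i (r b) = b" if "b \<in> carrier E" "p b = \<zero>\<^bsub>Q\<^esub>" for b
    using split[OF that(1)] that module_hom_zero[OF Q_mod E_mod s] i_closed[OF r_closed] by simp
  have i_B: "i (B a b) = F (i a) (i b)" if "a \<in> carrier S" "b \<in> carrier S" for a b
  proof -
    have "p (F (i a) (i b)) = \<zero>\<^bsub>Q\<^esub>"
      using that bilinear_zero_left[OF Q_mod Q_mod Q_mod F'] by (simp add: p_F i_closed pi)
    then show ?thesis using that by (simp add: B_eq ir i_closed F_closed)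
  qed
  have inj: "inj_on i (carrier S)" using ri by (rule inj_on_inverseI)
  have "B a (B b c) = B (B a b) c \<oplus>\<^bsub>S\<^esub> B b (B a c)"
    if abc: "a \<in> carrier S" "b \<in> carrier S" "c \<in> carrier S" for a b c
  proof (rule inj_onD[OF inj])
    have "F (i a) (F (i b) (i c)) = F (F (i a) (i b)) (i c) \<oplus>\<^bsub>E\<^esub> F (i b) (F (i a) (i c))"
      using E abc i_closed unfolding leibniz_algebra_def by blast
    then show "i (B a (B b c)) = i (B (B a b) c \<oplus>\<^bsub>S\<^esub> B b (B a c))"
      using abc by (simp add: i_B B_closed LinearCombinations.module_hom_add[OF i])
  qed (use abc B_closed in simp_all)
  then have "leibniz_algebra K S B"
    using S B unfolding leibniz_algebra_def by blast
  moreover have "leibniz_hom K S B E F i"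
    using mod_hom_if_module_hom[OF S_mod E_mod i] S E_vs i_B
    by (simp add: leibniz_hom_def linear_map_def)
  moreover have "short_exact S E Q i p"
    unfolding short_exact_def a_kernel_def'
  proof (intro conjI inj equalityI subsetI)
    show "b \<in> i ` carrier S" if "b \<in> {b \<in> carrier E. p b = \<zero>\<^bsub>Q\<^esub>}" for b
      using ir[of b] r_closed[of b] that by (metis (mono_tags, lifting) imageI mem_Collect_eq)
    show "c \<in> p ` carrier E" if "c \<in> carrier Q" for c
      using ps[OF that] module_hom_carrier[OF s that] by (metis imageI)
  qed (use i_closed pi p_closed in auto)
  ultimately show ?thesis
    using E Q p unfolding leibniz_extension_def by blast
qed


section \<open>Extensions of 3-Lie algebras\<close>

context
  fixes K G H
  assumes G: "module K G" and H: "module K H"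
begin

interpretation G: Module.module K G by (rule G)
interpretation H: Module.module K H by (rule H)
interpretation wH: Module.module K "ext_square K H" by (rule ext_square_module[OF H])
interpretation tGH: Module.module K "tensor_space K G H" by (rule tensor_space_module[OF G H])

lemma direct_sum_module: "module K (direct_sum G H)"
  by (rule direct_sum_is_module[OF G H])

lemma kernel_space_module: "module K (kernel_space K G H)"
  by (rule direct_sum_is_module[OF ext_square_module[OF H] tensor_space_module[OF G H]])

interpretation wE: Module.module K "ext_square K (direct_sum G H)"
  by (rule ext_square_module[OF direct_sum_module])

text \<open>The zeros of both summands are themselves decomposable, as 0 \<and> 0 and 0 \<otimes> 0.
  Pairs of decomposables therefore include the generators of each summand separately.\<close>

lemma kernel_space_hom_eqI:
  assumes P: "module K P" and f: "f \<in> module_hom K (kernel_space K G H) P"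
    and g: "g \<in> module_hom K (kernel_space K G H) P"
    and eq: "\<And>u v x w. u \<in> carrier H \<Longrightarrow> v \<in> carrier H \<Longrightarrow> x \<in> carrier G \<Longrightarrow> w \<in> carrier H \<Longrightarrow>
      f (wedge K H u v, tensor K G H x w) = g (wedge K H u v, tensor K G H x w)"
    and z: "z \<in> carrier (kernel_space K G H)"
  shows "f z = g z"
proof (rule direct_sum_hom_eqI[OF ext_square_module[OF H] tensor_space_module[OF G H] f g _ _ z])
  have zero: "wedge K H \<zero>\<^bsub>H\<^esub> \<zero>\<^bsub>H\<^esub> = \<zero>\<^bsub>ext_square K H\<^esub>"
      "tensor K G H \<zero>\<^bsub>G\<^esub> \<zero>\<^bsub>H\<^esub> = \<zero>\<^bsub>tensor_space K G H\<^esub>"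
    using wedge_same[OF H] bilinear_zero_left[OF G H tensor_space_module[OF G H] tensor_bilinear[OF G H]]
    by auto
  note inj1 = module_hom_inj1[OF ext_square_module[OF H] tensor_space_module[OF G H]]
  note inj2 = module_hom_inj2[OF ext_square_module[OF H] tensor_space_module[OF G H]]
  show "f (a, \<zero>\<^bsub>tensor_space K G H\<^esub>) = g (a, \<zero>\<^bsub>tensor_space K G H\<^esub>)"
    if "a \<in> carrier (ext_square K H)" for a
    by (rule ext_square_hom_eqI[OF H P module_hom_comp[OF inj1 f] module_hom_comp[OF inj1 g] _ that])
      (simp add: eq zero(2)[symmetric])
  show "f (\<zero>\<^bsub>ext_square K H\<^esub>, b) = g (\<zero>\<^bsub>ext_square K H\<^esub>, b)"
    if "b \<in> carrier (tensor_space K G H)" for b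
    by (rule tensor_space_hom_eqI[OF G H P module_hom_comp[OF inj2 f] module_hom_comp[OF inj2 g] _ that])
      (simp add: eq zero(1)[symmetric])
qed

lemma ext_square_projection_hom:
    "ext_square_projection K G H \<in> module_hom K (ext_square K (direct_sum G H)) (ext_square K G)"
  and ext_square_projection_wedge:
    "a \<in> carrier (direct_sum G H) \<Longrightarrow> b \<in> carrier (direct_sum G H) \<Longrightarrow>
      ext_square_projection K G H (wedge K (direct_sum G H) a b) = wedge K G (fst a) (fst b)"
proof -
  have "\<exists>f. f \<in> module_hom K (ext_square K (direct_sum G H)) (ext_square K G) \<and>
    (\<forall>x\<in>carrier G. \<forall>u\<in>carrier H. \<forall>y\<in>carrier G. \<forall>v\<in>carrier H.
      f (wedge K (direct_sum G H) (x, u) (y, v)) = wedge K G x y)"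
    using ext_square_map[OF direct_sum_module G module_hom_fst] by (auto simp: Bex_def)
  note spec = someI_ex[OF this, folded ext_square_projection_def]
  show "ext_square_projection K G H \<in> module_hom K (ext_square K (direct_sum G H)) (ext_square K G)"
    using spec by blast
  show "ext_square_projection K G H (wedge K (direct_sum G H) a b) = wedge K G (fst a) (fst b)"
    if "a \<in> carrier (direct_sum G H)" "b \<in> carrier (direct_sum G H)"
    using spec that by auto
qed

text \<open>The witness is a sum of one map per summand: the map of exterior squares induced by u
  \<mapsto> (0, u), and the lift to the tensor product of the bilinear map taking x and w to (x, 0)
  \<and> (0, w).\<close>

lemma kernel_inclusion_hom:
    "kernel_inclusion K G H \<in> module_hom K (kernel_space K G H) (ext_square K (direct_sum G H))"
  and kernel_inclusion_wedge_tensor: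
    "u \<in> carrier H \<Longrightarrow> v \<in> carrier H \<Longrightarrow> x \<in> carrier G \<Longrightarrow> w \<in> carrier H \<Longrightarrow>
      kernel_inclusion K G H (wedge K H u v, tensor K G H x w) =
        wedge K (direct_sum G H) (\<zero>\<^bsub>G\<^esub>, u) (\<zero>\<^bsub>G\<^esub>, v)
          \<oplus>\<^bsub>ext_square K (direct_sum G H)\<^esub> wedge K (direct_sum G H) (x, \<zero>\<^bsub>H\<^esub>) (\<zero>\<^bsub>G\<^esub>, w)"
proof -
  let ?E = "ext_square K (direct_sum G H)"
  note E = ext_square_module[OF direct_sum_module]
  obtain f1 where f1: "f1 \<in> module_hom K (ext_square K H) ?E"
    "\<forall>u\<in>carrier H. \<forall>v\<in>carrier H.
      f1 (wedge K H u v) = wedge K (direct_sum G H) (\<zero>\<^bsub>G\<^esub>, u) (\<zero>\<^bsub>G\<^esub>, v)"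
    using ext_square_map[OF H direct_sum_module module_hom_inj2[OF G H]] by auto
  have "\<exists>f\<in>module_hom K (tensor_space K G H) ?E. \<forall>x\<in>carrier G. \<forall>w\<in>carrier H.
    f (tensor K G H x w) = wedge K (direct_sum G H) (x, \<zero>\<^bsub>H\<^esub>) (\<zero>\<^bsub>G\<^esub>, w)"
    by (rule tensor_lift[OF G H E bilinear_comp[OF wedge_bilinear[OF direct_sum_module]
            module_hom_inj1[OF G H] module_hom_inj2[OF G H] module_hom_id]])
  then obtain f2 where f2: "f2 \<in> module_hom K (tensor_space K G H) ?E"
    "\<forall>x\<in>carrier G. \<forall>w\<in>carrier H.
      f2 (tensor K G H x w) = wedge K (direct_sum G H) (x, \<zero>\<^bsub>H\<^esub>) (\<zero>\<^bsub>G\<^esub>, w)"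
    by auto
  have "(\<lambda>z. f1 (fst z) \<oplus>\<^bsub>?E\<^esub> f2 (snd z)) \<in> module_hom K (kernel_space K G H) ?E"
    by (rule module_hom_add_fun[OF E module_hom_comp[OF module_hom_fst f1(1)]
          module_hom_comp[OF module_hom_snd f2(1)]])
  then have "\<exists>f. f \<in> module_hom K (kernel_space K G H) ?E \<and>
    (\<forall>u\<in>carrier H. \<forall>v\<in>carrier H. \<forall>x\<in>carrier G. \<forall>w\<in>carrier H.
      f (wedge K H u v, tensor K G H x w) =
        wedge K (direct_sum G H) (\<zero>\<^bsub>G\<^esub>, u) (\<zero>\<^bsub>G\<^esub>, v)
          \<oplus>\<^bsub>?E\<^esub> wedge K (direct_sum G H) (x, \<zero>\<^bsub>H\<^esub>) (\<zero>\<^bsub>G\<^esub>, w))"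
    using f1(2) f2(2) by (intro exI conjI) auto
  note spec = someI_ex[OF this, folded kernel_inclusion_def]
  show "kernel_inclusion K G H \<in> module_hom K (kernel_space K G H) ?E"
    using spec by blast
  show "kernel_inclusion K G H (wedge K H u v, tensor K G H x w) =
        wedge K (direct_sum G H) (\<zero>\<^bsub>G\<^esub>, u) (\<zero>\<^bsub>G\<^esub>, v)
          \<oplus>\<^bsub>?E\<^esub> wedge K (direct_sum G H) (x, \<zero>\<^bsub>H\<^esub>) (\<zero>\<^bsub>G\<^esub>, w)"
    if "u \<in> carrier H" "v \<in> carrier H" "x \<in> carrier G" "w \<in> carrier H"
    using spec that by blast
qed

text \<open>The minus sign comes from moving the element of G to the front: u \<and> y = - y \<and>
  u. The same sign makes the tensor component alternating, since x \<otimes> u - x \<otimes> u =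
  0.\<close>

lemma kernel_retraction_exists:
  "\<exists>r\<in>module_hom K (ext_square K (direct_sum G H)) (kernel_space K G H).
    \<forall>a\<in>carrier (direct_sum G H). \<forall>b\<in>carrier (direct_sum G H).
      r (wedge K (direct_sum G H) a b) = (wedge K H (snd a) (snd b),
        tensor K G H (fst a) (snd b) \<ominus>\<^bsub>tensor_space K G H\<^esub> tensor K G H (fst b) (snd a))"
proof (rule ext_square_lift[OF direct_sum_module kernel_space_module])
  note w = wedge_bilinear[OF H] and t = tensor_bilinear[OF G H]
  show "bilinear K (direct_sum G H) (direct_sum G H) (kernel_space K G H)
    (\<lambda>a b. (wedge K H (snd a) (snd b),
      tensor K G H (fst a) (snd b) \<ominus>\<^bsub>tensor_space K G H\<^esub> tensor K G H (fst b) (snd a)))"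
    by (rule bilinear_Pair[OF bilinear_comp[OF w module_hom_snd module_hom_snd module_hom_id]
          bilinear_minus_fun[OF tensor_space_module[OF G H]
            bilinear_comp[OF t module_hom_fst module_hom_snd module_hom_id]
            bilinear_flip[OF bilinear_comp[OF t module_hom_fst module_hom_snd module_hom_id]]]])
  show "(wedge K H (snd a) (snd a),
      tensor K G H (fst a) (snd a) \<ominus>\<^bsub>tensor_space K G H\<^esub> tensor K G H (fst a) (snd a)) =
      \<zero>\<^bsub>kernel_space K G H\<^esub>"
    if "a \<in> carrier (direct_sum G H)" for a
  proof -
    have "fst a \<in> carrier G" "snd a \<in> carrier H" using that by auto
    then show ?thesis
      using bilinear_closed[OF t] by (simp add: wedge_same[OF H] a_minus_def tGH.r_neg)
  qed
qed

text \<open>Each of the four identities equates linear maps, so generators suffice. The values of r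
  on wedges are part of the statement because the comparison of the brackets evaluates r
  there.\<close>

lemma kernel_split_exact:
  "\<exists>r s. r \<in> module_hom K (ext_square K (direct_sum G H)) (kernel_space K G H) \<and>
    (\<forall>a\<in>carrier (direct_sum G H). \<forall>b\<in>carrier (direct_sum G H).
      r (wedge K (direct_sum G H) a b) = (wedge K H (snd a) (snd b),
        tensor K G H (fst a) (snd b) \<ominus>\<^bsub>tensor_space K G H\<^esub> tensor K G H (fst b) (snd a))) \<and>
    s \<in> module_hom K (ext_square K G) (ext_square K (direct_sum G H)) \<and>
    (\<forall>a\<in>carrier (kernel_space K G H). r (kernel_inclusion K G H a) = a) \<and>
    (\<forall>a\<in>carrier (kernel_space K G H).
      ext_square_projection K G H (kernel_inclusion K G H a) = \<zero>\<^bsub>ext_square K G\<^esub>) \<and>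
    (\<forall>c\<in>carrier (ext_square K G). ext_square_projection K G H (s c) = c) \<and>
    (\<forall>b\<in>carrier (ext_square K (direct_sum G H)).
      kernel_inclusion K G H (r b) \<oplus>\<^bsub>ext_square K (direct_sum G H)\<^esub>
        s (ext_square_projection K G H b) = b)"
proof -
  let ?D = "direct_sum G H"
  let ?E = "ext_square K ?D" and ?S = "kernel_space K G H" and ?Q = "ext_square K G"
    and ?T = "tensor_space K G H"
  let ?i = "kernel_inclusion K G H" and ?p = "ext_square_projection K G H"
  let ?w = "wedge K ?D" and ?t = "tensor K G H"
  note D = direct_sum_module and S = kernel_space_module
  note E = ext_square_module[OF D] and Q = ext_square_module[OF G] and T = tensor_space_module[OF G H]
  note i = kernel_inclusion_hom and p = ext_square_projection_hom
  note i_gen = kernel_inclusion_wedge_tensor and p_gen = ext_square_projection_wedge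
  note bil = wedge_bilinear[OF D] and bilH = wedge_bilinear[OF H] and bilG = wedge_bilinear[OF G]
    and bilT = tensor_bilinear[OF G H]
  interpret Q: Module.module K ?Q by (rule Q)
  interpret D: Module.module K ?D by (rule D)
  obtain r where r: "r \<in> module_hom K ?E ?S"
    and r_gen: "\<forall>a\<in>carrier ?D. \<forall>b\<in>carrier ?D. r (?w a b) =
      (wedge K H (snd a) (snd b), ?t (fst a) (snd b) \<ominus>\<^bsub>?T\<^esub> ?t (fst b) (snd a))"
    using kernel_retraction_exists by blast
  obtain s where s: "s \<in> module_hom K ?Q ?E"
    and s_gen: "\<forall>x\<in>carrier G. \<forall>y\<in>carrier G. s (wedge K G x y) = ?w (x, \<zero>\<^bsub>H\<^esub>) (y, \<zero>\<^bsub>H\<^esub>)"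
    using ext_square_map[OF G D module_hom_inj1[OF G H]] by auto
  note simps = bilinear_closed[OF bil] bilinear_closed[OF bilH] bilinear_closed[OF bilG]
    bilinear_closed[OF bilT] bilinear_zero_left[OF H H ext_square_module[OF H] bilH]
    bilinear_zero_right[OF H H ext_square_module[OF H] bilH]
    bilinear_zero_left[OF G G Q bilG] bilinear_zero_right[OF G G Q bilG]
    bilinear_zero_left[OF G H T bilT] bilinear_zero_right[OF G H T bilT]
  show ?thesis
  proof (intro exI[of _ r] exI[of _ s] conjI ballI)
    show "r (?i a) = a" if "a \<in> carrier ?S" for a
      by (rule kernel_space_hom_eqI[OF S module_hom_comp[OF i r] module_hom_id _ that])
        (simp add: i_gen LinearCombinations.module_hom_add[OF r] r_gen simps a_minus_def
          tGH.a_inv_zero)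
    show "?p (?i a) = \<zero>\<^bsub>?Q\<^esub>" if "a \<in> carrier ?S" for a
      by (rule kernel_space_hom_eqI[OF Q module_hom_comp[OF i p] module_hom_zero_fun[OF Q] _ that])
        (simp add: i_gen LinearCombinations.module_hom_add[OF p] p_gen simps)
    show "?p (s c) = c" if "c \<in> carrier ?Q" for c
      by (rule ext_square_hom_eqI[OF G Q module_hom_comp[OF s p] module_hom_id _ that])
        (simp add: s_gen p_gen)
    show "?i (r b) \<oplus>\<^bsub>?E\<^esub> s (?p b) = b" if "b \<in> carrier ?E" for b
    proof (rule ext_square_hom_eqI[OF D E
          module_hom_add_fun[OF E module_hom_comp[OF r i] module_hom_comp[OF p s]] module_hom_id _ that])
      fix a b assume "a \<in> carrier ?D" "b \<in> carrier ?D"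
      then obtain x u y v where a: "a = (x, u)" "x \<in> carrier G" "u \<in> carrier H"
        and b: "b = (y, v)" "y \<in> carrier G" "v \<in> carrier H" by auto
      have flip: "?w (\<zero>\<^bsub>G\<^esub>, u) (y, \<zero>\<^bsub>H\<^esub>) = \<ominus>\<^bsub>?E\<^esub> ?w (y, \<zero>\<^bsub>H\<^esub>) (\<zero>\<^bsub>G\<^esub>, u)"
        using a b by (intro wedge_skew[OF D]) auto
      have cl: "(x, \<zero>\<^bsub>H\<^esub>) \<in> carrier ?D" "(\<zero>\<^bsub>G\<^esub>, u) \<in> carrier ?D"
        "(y, \<zero>\<^bsub>H\<^esub>) \<in> carrier ?D" "(\<zero>\<^bsub>G\<^esub>, v) \<in> carrier ?D"
        using a b by simp_all
      have a_eq: "a = (x, \<zero>\<^bsub>H\<^esub>) \<oplus>\<^bsub>?D\<^esub> (\<zero>\<^bsub>G\<^esub>, u)" and b_eq: "b = (y, \<zero>\<^bsub>H\<^esub>) \<oplus>\<^bsub>?D\<^esub> (\<zero>\<^bsub>G\<^esub>, v)"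
        using a b by simp_all
      have expand: "?w a b = ?w (x, \<zero>\<^bsub>H\<^esub>) (y, \<zero>\<^bsub>H\<^esub>) \<oplus>\<^bsub>?E\<^esub> ?w (x, \<zero>\<^bsub>H\<^esub>) (\<zero>\<^bsub>G\<^esub>, v) \<oplus>\<^bsub>?E\<^esub>
          (\<ominus>\<^bsub>?E\<^esub> ?w (y, \<zero>\<^bsub>H\<^esub>) (\<zero>\<^bsub>G\<^esub>, u) \<oplus>\<^bsub>?E\<^esub> ?w (\<zero>\<^bsub>G\<^esub>, u) (\<zero>\<^bsub>G\<^esub>, v))"
        unfolding a_eq b_eq flip[symmetric]
        by (simp add: cl bilinear_add_left[OF bil] bilinear_add_right[OF bil] bilinear_closed[OF bil]
            D.a_closed wE.a_ac del: direct_sum_sel)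
      \<comment> \<open>The value of \<open>kernel_inclusion\<close> is known on pairs of
        decomposables. So the term - y \<otimes> u is written as (- y) \<otimes> u and paired with 0
        \<and> 0, which splits the argument into two such pairs.\<close>
      have "r (?w a b) = (wedge K H u v, ?t x v) \<oplus>\<^bsub>?S\<^esub> (wedge K H \<zero>\<^bsub>H\<^esub> \<zero>\<^bsub>H\<^esub>, ?t (\<ominus>\<^bsub>G\<^esub> y) u)"
        using a b by (simp add: r_gen a_minus_def simps bilinear_a_inv_left[OF G H T bilT])
      then have "?i (r (?w a b)) = ?i (wedge K H u v, ?t x v) \<oplus>\<^bsub>?E\<^esub>
          ?i (wedge K H \<zero>\<^bsub>H\<^esub> \<zero>\<^bsub>H\<^esub>, ?t (\<ominus>\<^bsub>G\<^esub> y) u)"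
        using a b by (simp only:) (rule LinearCombinations.module_hom_add[OF i]; simp add: simps)
      moreover have "(\<ominus>\<^bsub>G\<^esub> y, \<zero>\<^bsub>H\<^esub>) = \<ominus>\<^bsub>?D\<^esub> (y, \<zero>\<^bsub>H\<^esub>)"
        using module_hom_a_inv[OF G D module_hom_inj1[OF G H] b(2)] .
      then have "?i (wedge K H \<zero>\<^bsub>H\<^esub> \<zero>\<^bsub>H\<^esub>, ?t (\<ominus>\<^bsub>G\<^esub> y) u) = \<ominus>\<^bsub>?E\<^esub> ?w (y, \<zero>\<^bsub>H\<^esub>) (\<zero>\<^bsub>G\<^esub>, u)"
        using a b cl i_gen[of "\<zero>\<^bsub>H\<^esub>" "\<zero>\<^bsub>H\<^esub>" "\<ominus>\<^bsub>G\<^esub> y" u]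
        by (simp add: wedge_same[OF D] bilinear_a_inv_left[OF D D E bil] bilinear_closed[OF bil])
      ultimately have "?i (r (?w a b)) = ?w (\<zero>\<^bsub>G\<^esub>, u) (\<zero>\<^bsub>G\<^esub>, v) \<oplus>\<^bsub>?E\<^esub> ?w (x, \<zero>\<^bsub>H\<^esub>) (\<zero>\<^bsub>G\<^esub>, v)
          \<oplus>\<^bsub>?E\<^esub> (\<ominus>\<^bsub>?E\<^esub> ?w (y, \<zero>\<^bsub>H\<^esub>) (\<zero>\<^bsub>G\<^esub>, u))"
        using a b by (simp add: i_gen)
      moreover have "s (?p (?w a b)) = ?w (x, \<zero>\<^bsub>H\<^esub>) (y, \<zero>\<^bsub>H\<^esub>)"
        using a b by (simp add: p_gen s_gen)
      ultimately show "?i (r (?w a b)) \<oplus>\<^bsub>?E\<^esub> s (?p (?w a b)) = ?w a b"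
        unfolding expand using a b by (simp add: bilinear_closed[OF bil] wE.a_ac)
    qed
  qed (use r r_gen s in blast)+
qed

end

section \<open>Comparison of the bracket on the kernel with the ambient fundamental bracket\<close>

theorem theorem5p2:
  fixes K :: "'k ring" and G :: "('k, 'g) module" and H :: "('k, 'h) module"
    and brG :: "'g \<Rightarrow> 'g \<Rightarrow> 'g \<Rightarrow> 'g" and brH :: "'h \<Rightarrow> 'h \<Rightarrow> 'h \<Rightarrow> 'h"
    and rho :: "'g \<Rightarrow> 'g \<Rightarrow> 'h \<Rightarrow> 'h" and nu :: "'g \<Rightarrow> 'h \<Rightarrow> 'h \<Rightarrow> 'h"
    and omega :: "'g \<Rightarrow> 'g \<Rightarrow> 'g \<Rightarrow> 'h"
  assumes "algebraically_closed K"
    and "\<forall>n::nat. n > 0 \<longrightarrow> [n] \<cdot>\<^bsub>K\<^esub> \<one>\<^bsub>K\<^esub> \<noteq> \<zero>\<^bsub>K\<^esub>"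
    and "three_lie_algebra K G brG" and "three_lie_algebra K H brH"
    and "extension_data K G H rho nu omega"
    and "three_lie_extension K H brH
           (direct_sum G H) (ext_bracket G brG H brH rho nu omega)
           G brG (inj2 G H) fst"
  shows "leibniz_extension K
           (kernel_space K G H) (kernel_bracket K G H brH rho nu)
           (ext_square K (direct_sum G H))
           (fundamental_bracket K (direct_sum G H) (ext_bracket G brG H brH rho nu omega))
           (ext_square K G) (fundamental_bracket K G brG)
           (kernel_inclusion K G H) (ext_square_projection K G H)"
proof -
  let ?D = "direct_sum G H" and ?br = "ext_bracket G brG H brH rho nu omega"
  let ?E = "ext_square K ?D" and ?S = "kernel_space K G H" and ?Q = "ext_square K G"
    and ?T = "tensor_space K G H" and ?W = "ext_square K H"
  let ?i = "kernel_inclusion K G H" and ?p = "ext_square_projection K G H"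
    and ?B = "kernel_bracket K G H brH rho nu"
  let ?F = "fundamental_bracket K ?D ?br"
  let ?w = "wedge K ?D" and ?wH = "wedge K H" and ?t = "tensor K G H"
  have lieD: "three_lie_algebra K ?D ?br" and fst_hom: "three_lie_hom K ?D ?br G brG fst"
    using assms(6) unfolding three_lie_extension_def by blast+
  note G = three_lie_module[OF assms(3)] and H = three_lie_module[OF assms(4)]
  note D = direct_sum_module[OF G H] and S = kernel_space_module[OF G H]
  note E = ext_square_module[OF D] and T = tensor_space_module[OF G H] and W = ext_square_module[OF H]
  interpret G: Module.module K G by (rule G)
  interpret H: Module.module K H by (rule H)
  interpret wE: Module.module K ?E by (rule E)
  interpret wH: Module.module K ?W by (rule W)
  interpret tGH: Module.module K ?T by (rule T)
  note i = kernel_inclusion_hom[OF G H] and p = ext_square_projection_hom[OF G H]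
  note i_gen = kernel_inclusion_wedge_tensor[OF G H]
  obtain r s where r: "r \<in> module_hom K ?E ?S"
    and r_gen: "\<forall>a\<in>carrier ?D. \<forall>b\<in>carrier ?D. r (?w a b) =
      (?wH (snd a) (snd b), ?t (fst a) (snd b) \<ominus>\<^bsub>?T\<^esub> ?t (fst b) (snd a))"
    and s: "s \<in> module_hom K ?Q ?E"
    and ri: "\<forall>a\<in>carrier ?S. r (?i a) = a"
    and pi: "\<forall>a\<in>carrier ?S. ?p (?i a) = \<zero>\<^bsub>?Q\<^esub>"
    and ps: "\<forall>c\<in>carrier ?Q. ?p (s c) = c"
    and split: "\<forall>b\<in>carrier ?E. ?i (r b) \<oplus>\<^bsub>?E\<^esub> s (?p b) = b"
    using kernel_split_exact[OF G H] by (elim exE conjE) (rule that)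
  note F = fundamental_bracket_bilinear[OF lieD]
  note bil = wedge_bilinear[OF D] and bilH = wedge_bilinear[OF H] and bilT = tensor_bilinear[OF G H]
  have rho: "trilinear K G G H H rho" and rho_same: "\<forall>x\<in>carrier G. \<forall>v\<in>carrier H. rho x x v = \<zero>\<^bsub>H\<^esub>"
    and nu: "trilinear K G H H H nu" and omega: "alternating_trilinear K G H omega"
    using assms(5) unfolding extension_data_def by blast+
  note omega_tri = omega[unfolded alternating_trilinear_def, THEN conjunct1]
  note triG = three_lie_trilinear[OF assms(3)] and triH = three_lie_trilinear[OF assms(4)]
  \<comment> \<open>The extension bracket of x, w, y contains rho(y, x) w, whereas the formula for
    {\<cdot>, \<cdot>} uses rho(x, y) w; this is the source of its minus sign.\<close>
  have rho_skew: "rho y x v = \<ominus>\<^bsub>H\<^esub> rho x y v"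
    if "x \<in> carrier G" "y \<in> carrier G" "v \<in> carrier H" for x y v
  proof (rule alternating_skew[OF G H])
    show "bilinear K G G H (\<lambda>x y. rho x y v)"
      unfolding bilinear_def
      by (intro conjI ballI trilinear_hom1[OF rho] trilinear_hom2[OF rho] that(3))
  qed (simp_all add: that rho_same)
  note br_closed = three_lie_closed[OF assms(4)] module_hom_carrier[OF trilinear_hom3[OF rho]]
    module_hom_carrier[OF trilinear_hom3[OF nu]]
  note zeros = module_hom_zero[OF G H trilinear_hom1[OF rho]] module_hom_zero[OF G H trilinear_hom2[OF rho]]
    module_hom_zero[OF H H trilinear_hom3[OF rho]]
    module_hom_zero[OF G H trilinear_hom1[OF nu]] module_hom_zero[OF H H trilinear_hom2[OF nu]]
    module_hom_zero[OF H H trilinear_hom3[OF nu]]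
    module_hom_zero[OF G H trilinear_hom1[OF omega_tri]] module_hom_zero[OF G H trilinear_hom2[OF omega_tri]]
    module_hom_zero[OF G H trilinear_hom3[OF omega_tri]]
    module_hom_zero[OF G G trilinear_hom1[OF triG]] module_hom_zero[OF G G trilinear_hom2[OF triG]]
    module_hom_zero[OF G G trilinear_hom3[OF triG]]
    module_hom_zero[OF H H trilinear_hom1[OF triH]] module_hom_zero[OF H H trilinear_hom2[OF triH]]
    module_hom_zero[OF H H trilinear_hom3[OF triH]]
  \<comment> \<open>An element i a contributes first arguments of type (H, H) or (G, H), and the
    third argument comes from H or G. In all four cases the value lies in H: at least two of the
    three G-components are zero, or \<open>rho\<close> is the only surviving term.\<close>
  have br_HHH: "?br (\<zero>\<^bsub>G\<^esub>, u) (\<zero>\<^bsub>G\<^esub>, v) (\<zero>\<^bsub>G\<^esub>, w) = (\<zero>\<^bsub>G\<^esub>, brH u v w)"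
    if "u \<in> carrier H" "v \<in> carrier H" "w \<in> carrier H" for u v w
    using that by (simp add: ext_bracket_def zeros br_closed)
  have br_HHG: "?br (\<zero>\<^bsub>G\<^esub>, u) (\<zero>\<^bsub>G\<^esub>, v) (x, \<zero>\<^bsub>H\<^esub>) = (\<zero>\<^bsub>G\<^esub>, nu x u v)"
    if "u \<in> carrier H" "v \<in> carrier H" "x \<in> carrier G" for u v x
    using that by (simp add: ext_bracket_def zeros br_closed)
  have br_GHH: "?br (x, \<zero>\<^bsub>H\<^esub>) (\<zero>\<^bsub>G\<^esub>, w) (\<zero>\<^bsub>G\<^esub>, u) = (\<zero>\<^bsub>G\<^esub>, nu x w u)"
    if "u \<in> carrier H" "w \<in> carrier H" "x \<in> carrier G" for u w x
    using that by (simp add: ext_bracket_def zeros br_closed)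
  have br_GHG: "?br (x, \<zero>\<^bsub>H\<^esub>) (\<zero>\<^bsub>G\<^esub>, w) (y, \<zero>\<^bsub>H\<^esub>) = (\<zero>\<^bsub>G\<^esub>, \<ominus>\<^bsub>H\<^esub> rho x y w)"
    if "w \<in> carrier H" "x \<in> carrier G" "y \<in> carrier G" for w x y
    using that rho_skew[OF that(2,3,1)] by (simp add: ext_bracket_def zeros br_closed)
  \<comment> \<open>Expanding both arguments gives eight wedges, each of the form (0, u) \<and> (0,
    v) or (x2, 0) \<and> (0, w). On these r returns u \<and> v in the first component or x2
    \<otimes> w in the second, which sorts the terms into six and two.\<close>
  have r_bracket: "r (?F (?i (?wH u1 v1, ?t x1 w1)) (?i (?wH u2 v2, ?t x2 w2))) =
        (?wH (brH u1 v1 u2) v2 \<oplus>\<^bsub>?W\<^esub> ?wH u2 (brH u1 v1 v2) \<oplus>\<^bsub>?W\<^esub> ?wH (nu x2 u1 v1) w2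
           \<oplus>\<^bsub>?W\<^esub> ?wH (nu x1 w1 u2) v2 \<oplus>\<^bsub>?W\<^esub> ?wH u2 (nu x1 w1 v2) \<ominus>\<^bsub>?W\<^esub> ?wH (rho x1 x2 w1) w2,
         ?t x2 (brH u1 v1 w2) \<oplus>\<^bsub>?T\<^esub> ?t x2 (nu x1 w1 w2))"
    if "u1 \<in> carrier H" "v1 \<in> carrier H" "x1 \<in> carrier G" "w1 \<in> carrier H"
      "u2 \<in> carrier H" "v2 \<in> carrier H" "x2 \<in> carrier G" "w2 \<in> carrier H"
    for u1 v1 x1 w1 u2 v2 x2 w2
    using that
    by (simp add: i_gen bilinear_add_left[OF F] bilinear_add_right[OF F] bilinear_closed[OF F]
        bilinear_closed[OF bil] fundamental_bracket_wedge[OF lieD] br_HHH br_HHG br_GHH br_GHG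
        br_closed LinearCombinations.module_hom_add[OF r] r_gen
        bilinear_closed[OF bilH] bilinear_closed[OF bilT]
        bilinear_zero_left[OF H H W bilH] bilinear_zero_right[OF H H W bilH]
        bilinear_zero_left[OF G H T bilT] bilinear_zero_right[OF G H T bilT]
        bilinear_a_inv_left[OF H H W bilH] a_minus_def wH.a_ac tGH.a_inv_zero)
  \<comment> \<open>The transported bracket satisfies the specification, so the choice in
    \<open>kernel_bracket\<close> does yield a bilinear map with the prescribed values.\<close>
  have "\<exists>B. bilinear K ?S ?S ?S B \<and>
    (\<forall>u1\<in>carrier H. \<forall>v1\<in>carrier H. \<forall>x1\<in>carrier G. \<forall>w1\<in>carrier H.
     \<forall>u2\<in>carrier H. \<forall>v2\<in>carrier H. \<forall>x2\<in>carrier G. \<forall>w2\<in>carrier H.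
      B (?wH u1 v1, ?t x1 w1) (?wH u2 v2, ?t x2 w2) =
        (?wH (brH u1 v1 u2) v2 \<oplus>\<^bsub>?W\<^esub> ?wH u2 (brH u1 v1 v2) \<oplus>\<^bsub>?W\<^esub> ?wH (nu x2 u1 v1) w2
           \<oplus>\<^bsub>?W\<^esub> ?wH (nu x1 w1 u2) v2 \<oplus>\<^bsub>?W\<^esub> ?wH u2 (nu x1 w1 v2) \<ominus>\<^bsub>?W\<^esub> ?wH (rho x1 x2 w1) w2,
         ?t x2 (brH u1 v1 w2) \<oplus>\<^bsub>?T\<^esub> ?t x2 (nu x1 w1 w2)))"
    by (intro exI[of _ "\<lambda>a b. r (?F (?i a) (?i b))"] conjI ballI bilinear_comp[OF F i i r])
      (rule r_bracket)
  note B = someI_ex[OF this, folded kernel_bracket_def]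
  have B_gen: "?B (?wH u1 v1, ?t x1 w1) (?wH u2 v2, ?t x2 w2) =
      r (?F (?i (?wH u1 v1, ?t x1 w1)) (?i (?wH u2 v2, ?t x2 w2)))"
    if "u1 \<in> carrier H" "v1 \<in> carrier H" "x1 \<in> carrier G" "w1 \<in> carrier H"
      "u2 \<in> carrier H" "v2 \<in> carrier H" "x2 \<in> carrier G" "w2 \<in> carrier H"
    for u1 v1 x1 w1 u2 v2 x2 w2
    unfolding r_bracket[OF that] using conjunct2[OF B] that by blast
  note B_bil = conjunct1[OF B] and rF_bil = bilinear_comp[OF F i i r]
  have gen_closed: "(?wH u v, ?t x w) \<in> carrier ?S"
    if "u \<in> carrier H" "v \<in> carrier H" "x \<in> carrier G" "w \<in> carrier H" for u v x w
    using that by (simp add: bilinear_closed[OF bilH] bilinear_closed[OF bilT])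
  \<comment> \<open>Two bilinear maps that agree on pairs of decomposables agree everywhere; the
    second argument is freed first, then the first.\<close>
  have B_gen1: "?B (?wH u v, ?t x w) b = r (?F (?i (?wH u v, ?t x w)) (?i b))"
    if "u \<in> carrier H" "v \<in> carrier H" "x \<in> carrier G" "w \<in> carrier H" "b \<in> carrier ?S"
    for u v x w b
    by (rule kernel_space_hom_eqI[OF G H S bilinear_hom_right[OF B_bil gen_closed[OF that(1-4)]]
          bilinear_hom_right[OF rF_bil gen_closed[OF that(1-4)]] B_gen[OF that(1-4)] that(5)])
  have B_eq: "?B a b = r (?F (?i a) (?i b))" if "a \<in> carrier ?S" "b \<in> carrier ?S" for a b
    by (rule kernel_space_hom_eqI[OF G H S bilinear_hom_left[OF B_bil that(2)]
          bilinear_hom_left[OF rF_bil that(2)] B_gen1[OF _ _ _ _ that(2)] that(1)])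
  have "vectorspace K ?S"
    using S assms(3) unfolding three_lie_algebra_def vectorspace_def by blast
  moreover have "leibniz_hom K ?E ?F ?Q (fundamental_bracket K G brG) ?p"
    by (rule leibniz_hom_fundamental[OF lieD assms(3) fst_hom p ext_square_projection_wedge[OF G H]])
  ultimately show ?thesis
    by (rule leibniz_extension_split[OF _ fundamental_bracket_leibniz_algebra[OF lieD]
          fundamental_bracket_leibniz_algebra[OF assms(3)] _ i r s
          bspec[OF ri] bspec[OF pi] bspec[OF ps] bspec[OF split] B_bil B_eq])
qed

end
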